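(* (Upper tail) There exist constants $c,C,\delta>0$ such that for all $n\ge1$, any $v\in[n]$ and any $S\in[1,\delta n/v]$, $$\frac{c}{S}\ \le\ \mathbb{P}\big(\widehat\sigma_J(v)\ge Sv\big)\ \le\ \frac{C}{S}.$$ The upper bound holds for all $S\ge1$. (Lower tail) Moreover, there exist constants $c',c'',C',C'',\delta'>0$ such that for all $n\ge1$, any vertex $v\in[n/2]$ and any $S\in[1,\min(\sqrt v,\delta' v)]$, $$c''\exp(-C''S)\ \le\ \mathbb{P}\Big(\widehat\sigma_J(v)\le\frac1S v\Big)\ \le\ C'\exp(-c'S).$$ The upper bound holds for all $v\in[n]$ and $S\in[1,\sqrt v]$; the lower bound holds for all $v\in[n/2]$ and $S\in[1,\delta' v]$. Here $\widehat\sigma_J$ is the Jordan ordering of the uniform random recursive tree $T_n$.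
   Context: For real $x$, $[x]$ is the set of integers $i$ with $1\le i\le x$. The uniform random recursive tree $T_n$ on vertex set $[n]$ is sampled recursively: $T_1$ is the single vertex $1$ (the root); given $T_n$, choose $u\in\{1,\dots,n\}$ uniformly at random, independently of $T_1,\dots,T_n$, and add a new vertex $n+1$ together with the edge $\{u,n+1\}$. For a finite tree $t$ and vertices $u,v$, let $(t,u)_{v\downarrow}$ be the subtree of $v$ in the tree $t$ rooted at $u$ (the vertices $w$ such that $v$ lies on the path from $u$ to $w$), and $|\cdot|$ its number of vertices. The Jordan centrality is $\phi_t(v)=\min_{u\sim v}|(t,u)_{v\downarrow}|$, the minimum being over neighbors $u$ of $v$ in $t$. The Jordan ordering $\widehat\sigma_J$ ranks the vertices of $T_n$ decreasingly by $\phi_{T_n}$ (the vertex with largest value gets rank $1$), with uniformly random tie-breaking; $\widehat\sigma_J(v)\in[n]$ is the rank of $v$ (for $n=1$ the only vertex has rank $1$). *)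

theory Defs
  imports "HOL-Probability.Probability"
begin

text \<open>A simple graph is a pair of its vertex set and its set of edges, each edge \<open>{u, v}\<close> being an
  unordered pair of distinct vertices.\<close>

type_synonym 'a graph = "'a set \<times> 'a set set"

abbreviation verts :: "'a graph \<Rightarrow> 'a set" where "verts \<equiv> fst"
abbreviation edges :: "'a graph \<Rightarrow> 'a set set" where "edges \<equiv> snd"

definition neighbors :: "'a graph \<Rightarrow> 'a \<Rightarrow> 'a set" where
  "neighbors t v = {u \<in> verts t. {u, v} \<in> edges t}"

definition is_path :: "'a graph \<Rightarrow> 'a \<Rightarrow> 'a list \<Rightarrow> 'a \<Rightarrow> bool" where
  "is_path t u p w \<longleftrightarrow> p \<noteq> [] \<and> hd p = u \<and> last p = w \<and> distinct p \<and> set p \<subseteq> verts t \<and>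
     successively (\<lambda>x y. {x, y} \<in> edges t) p"

text \<open>\<open>subtree t u v\<close> is the vertex set of the subtree of \<open>v\<close> in \<open>t\<close> rooted at \<open>u\<close>. In a tree the
  path from \<open>u\<close> to \<open>w\<close> exists and is unique, so ``some path'' here means ``the path''.\<close>

definition subtree :: "'a graph \<Rightarrow> 'a \<Rightarrow> 'a \<Rightarrow> 'a set" where
  "subtree t u v = {w \<in> verts t. \<exists>p. is_path t u p w \<and> v \<in> set p}"

text \<open>On the one-vertex tree the minimum is over the empty set and hence unspecified; the ordering
  below does not depend on its value there.\<close>

definition jordan_centrality :: "'a graph \<Rightarrow> 'a \<Rightarrow> nat" where
  "jordan_centrality t v = Min ((\<lambda>u. card (subtree t u v)) ` neighbors t v)"

text \<open>All rankings of a finite vertex set \<open>V\<close> that are decreasing in the score \<open>f\<close>; they differ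
  only in how ties are broken. Ranks are normalised to \<open>undefined\<close> outside \<open>V\<close>, so that each
  ranking is represented by exactly one function.\<close>

definition rankings :: "'a set \<Rightarrow> ('a \<Rightarrow> nat) \<Rightarrow> ('a \<Rightarrow> nat) set" where
  "rankings V f = {\<sigma> \<in> extensional V. bij_betw \<sigma> V {1..card V} \<and>
     (\<forall>u\<in>V. \<forall>v\<in>V. f u > f v \<longrightarrow> \<sigma> u < \<sigma> v)}"

lemma finite_rankings:
  assumes "finite V"
  shows "finite (rankings V f)"
proof (rule finite_subset)
  show "rankings V f \<subseteq> PiE V (\<lambda>_. {1..card V})"
    by (auto simp: rankings_def PiE_def bij_betw_def)
  show "finite (PiE V (\<lambda>_. {1..card V}))"
    using assms by (intro finite_PiE) auto
qed

lemma rankings_nonempty: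
  assumes "finite V"
  shows "rankings V f \<noteq> {}"
  using assms
proof (induction "card V" arbitrary: V)
  case 0
  then show ?case by (auto simp: rankings_def bij_betw_def extensional_def)
next
  case (Suc n)
  then have "V \<noteq> {}" by auto
  then obtain m where m: "m \<in> V" "\<And>v. v \<in> V \<Longrightarrow> f m \<le> f v"
    using ex_min_if_finite[of "f ` V"] Suc.prems
    by (metis (no_types, lifting) Suc.prems arg_min_if_finite(1) arg_min_least)
  define W where "W = V - {m}"
  have W: "finite W" "n = card W" "V = insert m W" "m \<notin> W" "card V = Suc (card W)"
    using Suc m by (auto simp: W_def)
  with Suc.hyps(1)[of W] obtain \<sigma> where s: "\<sigma> \<in> rankings W f" by auto
  have b: "bij_betw \<sigma> W {1..card W}" using s by (simp add: rankings_def)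
  have "bij_betw (\<sigma>(m := card V)) V {1..card V}"
  proof -
    have "bij_betw (\<sigma>(m := card V)) W {1..card W}"
      using b W by (subst bij_betw_cong[of W _ \<sigma>]) auto
    then have "bij_betw (\<sigma>(m := card V)) (W \<union> {m}) ({1..card W} \<union> {card V})"
      using W by (intro bij_betw_combine) (auto simp: bij_betw_def)
    moreover have "{1..card W} \<union> {card V} = {1..card V}" using W by auto
    ultimately show ?thesis using W by simp
  qed
  moreover have "\<sigma> x < card V" if "x \<in> W" for x
    using bij_betw_apply[OF b that] W by auto
  ultimately have "\<sigma>(m := card V) \<in> rankings V f"
    using s W m(2) by (auto simp: rankings_def extensional_def leD)
  then show ?case by blast
qed

definition jordan_ordering :: "'a graph \<Rightarrow> ('a \<Rightarrow> nat) pmf" where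
  "jordan_ordering t = pmf_of_set (rankings (verts t) (jordan_centrality t))"

text \<open>The law of the uniform random recursive tree on \<open>{1..n}\<close>; the value at \<open>0\<close> is a dummy.\<close>

fun recursive_tree :: "nat \<Rightarrow> nat graph pmf" where
  "recursive_tree 0 = return_pmf ({}, {})"
| "recursive_tree (Suc 0) = return_pmf ({1}, {})"
| "recursive_tree (Suc (Suc k)) = do {
     (V, E) \<leftarrow> recursive_tree (Suc k);
     u \<leftarrow> pmf_of_set {1..Suc k};
     return_pmf (insert (Suc (Suc k)) V, insert {u, Suc (Suc k)} E)
   }"

definition rrt_jordan_ordering :: "nat \<Rightarrow> (nat \<Rightarrow> nat) pmf" where
  "rrt_jordan_ordering n = bind_pmf (recursive_tree n) jordan_ordering"

end

theory Submission
  imports Defs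
begin

text \<open>
  Root the tree at \<open>1\<close> and let \<open>D v\<close> be the number of descendants of \<open>v\<close>, including \<open>v\<close>. Removing the
  edge from \<open>v\<close> to its parent leaves \<open>D v\<close> vertices on the side of \<open>v\<close>, and removing an edge to a child
  \<open>c\<close> leaves \<open>n - D c\<close>. Hence, apart from the root, the centrality of \<open>v\<close> equals \<open>D v\<close> unless \<open>v\<close> has a child
  \<open>c\<close> with \<open>D c > n - D v\<close>. This happens only for the few vertices with more than half of the tree below
  them, and ranking by centrality is nearly ranking by \<open>D\<close>.

  After time \<open>v\<close> the subtree of \<open>v\<close> grows like a Polya urn started with one ball out of \<open>v\<close>, so
  \<open>P (D v > z)\<close> is the explicit quotient \<open>tail v n z\<close> of binomial coefficients, close to
  \<open>(1 - z / n) ^ (v - 1)\<close>: the fraction \<open>D v / n\<close> behaves like an exponential variable \<open>X\<close> divided by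
  \<open>v\<close>. Since about \<open>n / z\<close> vertices have more than \<open>z\<close> descendants, the rank of \<open>v\<close> is about \<open>v / X\<close>. It
  exceeds \<open>S v\<close> when \<open>X < 1 / S\<close>, which has probability of order \<open>1 / S\<close>, and it is below \<open>v / S\<close> when
  \<open>X > S\<close>, which has probability of order \<open>exp (- S)\<close>. The work lies in controlling the number of
  vertices that beat \<open>v\<close>, jointly with \<open>D v\<close>.

  The tool is the decomposition of the tree at a time \<open>m\<close>: every vertex belongs to the block of its
  ancestor at time \<open>m\<close>. The masses of disjoint sets of blocks evolve as the colours of an urn that does
  not depend on the tree at time \<open>m\<close>, and they are negatively dependent: for non-increasing
  non-negative functions of the masses, the expectation of the product is at most the product of the
  expectations (\<open>expect_prod_mass_le\<close>). Ancestry is the only source of positive dependence between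
  \<open>D u\<close> and \<open>D w\<close>, and for \<open>u < w\<close> the event that \<open>w\<close> descends from \<open>u\<close> is independent of \<open>D w\<close> and has
  probability \<open>1 / u\<close>.

  \<^item> Upper tail, from above (\<open>rank_upper_tail_le\<close>): with probability \<open>1 - O(1 / S)\<close> the centrality of \<open>v\<close>
    exceeds a threshold \<open>z\<close> of order \<open>n / (S v)\<close>, and Chebyshev's inequality bounds the number of
    vertices with more than \<open>z\<close> descendants.
  \<^item> Upper tail, from below (\<open>rank_upper_tail_ge\<close>): with probability of order \<open>1 / S\<close> the vertex \<open>v\<close>
    has no other descendant at a time \<open>M\<close> of order \<open>S v\<close>. Its block is then one among \<open>M\<close>
    exchangeable ones, and with positive probability it is small while more than \<open>S v\<close> others are not.
  \<^item> Lower tail, from above (\<open>rank_lower_tail_le\<close>): a union bound over subsets of the blocks at a time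
    \<open>M\<close> of order \<open>v / S\<close> shows that half of these blocks are large except with a
    probability exponentially small in \<open>M\<close>, and \<open>S \<le> sqrt v\<close> gives \<open>M \<ge> S\<close>.
  \<^item> Lower tail, from below (\<open>rank_lower_tail_ge\<close>): let the parent of \<open>v\<close> be among the first \<open>v / (4 S)\<close>
    vertices, which costs a factor of order \<open>1 / S\<close> only and prevents \<open>v\<close> from having many large
    ancestors. Given that moreover \<open>D v\<close> is of order \<open>S n / v\<close>, a first moment computation bounds the
    number of other vertices of this size.
\<close>


section \<open>Recursive trees as parent functions\<close>

definition valid_parents :: "nat \<Rightarrow> (nat \<Rightarrow> nat) \<Rightarrow> bool" where
  "valid_parents n f \<longleftrightarrow> (\<forall>i\<in>{2..n}. 1 \<le> f i \<and> f i < i)"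

text \<open>The ancestor of \<open>i\<close> among the vertices present at time \<open>m\<close>. The case \<open>i \<le> f i\<close> makes the recursion
  terminate for arbitrary \<open>f\<close>; it does not arise when \<open>f\<close> is a valid parent function.\<close>

function block :: "(nat \<Rightarrow> nat) \<Rightarrow> nat \<Rightarrow> nat \<Rightarrow> nat" where
  "block f m i = (if i \<le> m \<or> i \<le> f i then i else block f m (f i))"
  by auto
termination by (relation "Wellfounded.measure (\<lambda>(f, m, i). i)") auto

declare block.simps [simp del]

definition tree_of :: "nat \<Rightarrow> (nat \<Rightarrow> nat) \<Rightarrow> nat graph" where
  "tree_of n f = ({1..n}, (\<lambda>i. {f i, i}) ` {2..n})"

text \<open>The number of vertices at time \<open>n\<close> that hang off the set \<open>W\<close> of vertices of time \<open>m\<close>, where a vertex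
  that joined by time \<open>m\<close> hangs off itself only.\<close>

definition mass :: "(nat \<Rightarrow> nat) \<Rightarrow> nat \<Rightarrow> nat set \<Rightarrow> nat \<Rightarrow> nat" where
  "mass f m W n = card {i\<in>{1..n}. block f m i \<in> W}"

text \<open>The vertices of the subtree of \<open>v\<close>. Descendants of \<open>v\<close> are younger than \<open>v\<close>, hence exactly those whose
  block at time \<open>v\<close> is that of \<open>v\<close>.\<close>

definition desc :: "(nat \<Rightarrow> nat) \<Rightarrow> nat \<Rightarrow> nat \<Rightarrow> nat set" where
  "desc f n v = {i\<in>{1..n}. block f v i = v}"

abbreviation desc_count :: "(nat \<Rightarrow> nat) \<Rightarrow> nat \<Rightarrow> nat \<Rightarrow> nat" where
  "desc_count f n v \<equiv> card (desc f n v)"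

lemma desc_count_eq_mass: "desc_count f n v = mass f v {v} n"
  by (simp add: desc_def mass_def)

lemma block_le [simp]: "i \<le> m \<Longrightarrow> block f m i = i"
  by (simp add: block.simps)

lemma parent_less:
  assumes "valid_parents n f" "i \<in> {2..n}"
  shows "f i < i" "1 \<le> f i" "f i \<in> {1..n}"
proof -
  show "f i < i" "1 \<le> f i" using assms unfolding valid_parents_def by blast+
  then show "f i \<in> {1..n}" using assms(2) by auto
qed

lemma block_parent: "valid_parents n f \<Longrightarrow> i \<in> {2..n} \<Longrightarrow> m < i \<Longrightarrow> block f m i = block f m (f i)"
  using parent_less[of n f i] by (subst block.simps) auto

lemma block_block: "m \<le> m' \<Longrightarrow> block f m (block f m' i) = block f m i"
proof (induction f m' i rule: block.induct)
  case (1 f m' i)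
  show ?case
  proof (cases "i \<le> m' \<or> i \<le> f i")
    case True
    then show ?thesis by (simp add: block.simps[of f m' i])
  next
    case False
    then show ?thesis using 1 by (simp add: block.simps[of f m' i] block.simps[of f m i])
  qed
qed

lemma block_range:
  "valid_parents n f \<Longrightarrow> i \<in> {1..n} \<Longrightarrow> 1 \<le> m \<Longrightarrow> block f m i \<in> {1..m}"
proof (induction f m i rule: block.induct)
  case (1 f m i)
  show ?case
  proof (cases "i \<le> m")
    case True
    then show ?thesis using 1 by simp
  next
    case False
    then have i: "i \<in> {2..n}" using 1 by auto
    then have "f i \<in> {1..n}" "\<not> i \<le> f i" using parent_less[OF 1(2), of i] by auto
    then show ?thesis using 1 False i by (simp add: block_parent)
  qed
qed

lemma block_le_self: "block f m i \<le> i"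
proof (induction f m i rule: block.induct)
  case (1 f m i)
  then show ?case by (cases "i \<le> m \<or> i \<le> f i") (auto simp: block.simps[of f m i])
qed

lemma block_cong:
  "(\<And>j. j \<le> i \<Longrightarrow> f j = g j) \<Longrightarrow> block f m i = block g m i"
proof (induction f m i rule: block.induct)
  case (1 f m i)
  have fg: "f i = g i" using 1(2) by simp
  show ?case
  proof (cases "i \<le> m \<or> i \<le> f i")
    case True
    then show ?thesis using fg by (subst (1 2) block.simps) auto
  next
    case False
    then have "block f m (f i) = block g m (f i)" using 1 by auto
    then show ?thesis using fg False by (subst (1 2) block.simps) auto
  qed
qed

text \<open>Blocks of an earlier time are unions of blocks of a later time. This lets one reveal the tree up to
  time \<open>M\<close> first and treat what happens afterwards as an urn started from \<open>M\<close> balls.\<close>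

lemma mass_refine:
  assumes "valid_parents n f" "1 \<le> M" "m \<le> M"
  shows "mass f m W n = mass f M {w\<in>{1..M}. block f m w \<in> W} n"
  unfolding mass_def
  using block_range[OF assms(1) _ assms(2)] block_block[OF assms(3)]
  by (intro arg_cong[where f = card]) auto

lemma mass_initial: "W \<subseteq> {1..m} \<Longrightarrow> mass f m W m = card W"
  unfolding mass_def by (intro arg_cong[where f = card]) auto

lemma mass_le: "mass f m W n \<le> n"
  unfolding mass_def by (rule order_trans[OF card_mono[of "{1..n}"]]) auto

text \<open>The urn dynamics: choosing the parent \<open>u\<close> of the new vertex is drawing a ball, and a ball of the same
  colour is added.\<close>

lemma mass_step:
  assumes "valid_parents n f" "u \<in> {1..n}" "m \<le> n"
  shows "mass (f(Suc n := u)) m W (Suc n) = mass f m W n + of_bool (block f m u \<in> W)"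
proof -
  let ?g = "f(Suc n := u)"
  have old: "block ?g m i = block f m i" if "i \<le> n" for i
    using that by (intro block_cong) auto
  have new: "block ?g m (Suc n) = block f m u"
    using assms by (subst block.simps) (auto simp: old)
  have "{i\<in>{1..Suc n}. block ?g m i \<in> W} =
      {i\<in>{1..n}. block f m i \<in> W} \<union> (if block f m u \<in> W then {Suc n} else {})"
    using old new by (auto simp: le_Suc_eq)
  then show ?thesis by (auto simp: mass_def card_insert_if)
qed


section \<open>Centrality in terms of descendant counts\<close>

text \<open>The induction removes the younger of the two end points, which is not the root \<open>r\<close> and can be replaced
  by its parent. The bound \<open>max x y\<close> keeps the younger end point off the path from its parent to the
  other one, so that the extended path has distinct vertices.\<close>

lemma parent_closed_connected:
  assumes Z: "Z \<subseteq> {1..n}" "\<And>i. i \<in> Z \<Longrightarrow> r \<le> i"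
    and f: "\<And>i. i \<in> Z \<Longrightarrow> i \<noteq> r \<Longrightarrow> i \<in> {2..n} \<and> f i \<in> Z \<and> f i < i"
  shows "x \<in> Z \<Longrightarrow> y \<in> Z \<Longrightarrow> \<exists>p. is_path (tree_of n f) x p y \<and> set p \<subseteq> Z \<inter> {..max x y}"
proof (induction "x + y" arbitrary: x y rule: less_induct)
  case less
  consider "x = y" | "x < y" | "y < x" by linarith
  then show ?case
  proof cases
    case 1
    then have "is_path (tree_of n f) x [x] y \<and> set [x] \<subseteq> Z \<inter> {..max x y}"
      using less Z by (auto simp: is_path_def tree_of_def)
    then show ?thesis by blast
  next
    case 2
    then have "y \<noteq> r" using Z(2) less by force
    then have y: "y \<in> {2..n}" "f y \<in> Z" "f y < y" using f less by auto
    then obtain p where p: "is_path (tree_of n f) x p (f y)" "set p \<subseteq> Z \<inter> {..max x (f y)}"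
      using less(1)[of x "f y"] less(2) by auto
    have "is_path (tree_of n f) x (p @ [y]) y"
      using p y 2 less by (auto simp: is_path_def tree_of_def successively_append_iff)
    then show ?thesis using p y less 2 by (intro exI[of _ "p @ [y]"]) auto
  next
    case 3
    then have "x \<noteq> r" using Z(2) less by force
    then have x: "x \<in> {2..n}" "f x \<in> Z" "f x < x" using f less by auto
    then obtain p where p: "is_path (tree_of n f) (f x) p y" "set p \<subseteq> Z \<inter> {..max (f x) y}"
      using less(1)[of "f x" y] less(3) by auto
    have "is_path (tree_of n f) x (x # p) y"
      using p x 3 less by (auto simp: is_path_def tree_of_def successively_Cons insert_commute)
    then show ?thesis using p x less 3 by (intro exI[of _ "x # p"]) auto
  qed
qed

lemma successively_crossing:
  assumes "successively R p" "p \<noteq> []" "hd p \<in> B" "last p \<notin> B"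
  shows "\<exists>x y. x \<in> B \<and> y \<notin> B \<and> R x y \<and> x \<in> set p \<and> y \<in> set p"
  using assms
proof (induction p)
  case (Cons a p)
  show ?case
  proof (cases "p \<noteq> [] \<and> hd p \<in> B")
    case True
    then show ?thesis using Cons by (auto simp: successively_Cons)
  next
    case False
    then show ?thesis using Cons by (cases p) auto
  qed
qed auto

text \<open>A path from \<open>a\<close> that reaches \<open>b\<close> has crossed the only edge between the two sides; to come back to \<open>A\<close> it
  would have to pass through \<open>a\<close> a second time.\<close>

lemma subtree_across_bridge:
  assumes ab: "a \<in> A" "b \<in> B" "{a, b} \<in> edges t"
    and V: "verts t = A \<union> B" "A \<inter> B = {}"
    and bridge: "\<And>x y. x \<in> B \<Longrightarrow> y \<in> A \<Longrightarrow> {x, y} \<in> edges t \<Longrightarrow> y = a"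
    and conn: "\<And>w. w \<in> B \<Longrightarrow> \<exists>p. is_path t b p w \<and> set p \<subseteq> B"
  shows "subtree t a b = B"
proof (intro set_eqI iffI)
  fix w assume w: "w \<in> B"
  then obtain p where p: "is_path t b p w" "set p \<subseteq> B" using conn by blast
  then have "is_path t a (a # p) w" "b \<in> set (a # p)"
    using ab V by (auto simp: is_path_def successively_Cons)
  then show "w \<in> subtree t a b" using w V by (auto simp: subtree_def)
next
  fix w assume "w \<in> subtree t a b"
  then obtain p where w: "w \<in> A \<union> B" and p: "is_path t a p w" "b \<in> set p"
    using V by (auto simp: subtree_def)
  show "w \<in> B"
  proof (rule ccontr)
    assume "w \<notin> B"
    obtain q r where q: "p = q @ b # r" using p(2) by (auto simp: in_set_conv_decomp)
    have s: "successively (\<lambda>x y. {x, y} \<in> edges t) (b # r)" "set (b # r) \<subseteq> A \<union> B"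
      using p(1) q V by (auto simp: is_path_def successively_append_iff)
    have "last (b # r) = w" using p(1) q by (auto simp: is_path_def)
    then obtain x y where "x \<in> B" "y \<notin> B" "{x, y} \<in> edges t" "y \<in> set (b # r)"
      using successively_crossing[OF s(1), of B] ab \<open>w \<notin> B\<close> by auto
    then have "a \<in> set (b # r)" using bridge s(2) by blast
    moreover have "q \<noteq> []" "hd q = a"
      using p(1) q ab V by (cases q; auto simp: is_path_def)+
    ultimately show False using p(1) q by (cases q) (auto simp: is_path_def)
  qed
qed

lemma desc_parent:
  assumes "valid_parents n f" "i \<in> {2..n}" "i \<noteq> c" "1 \<le> c"
  shows "f i \<in> desc f n c \<longleftrightarrow> i \<in> desc f n c"
proof (cases "c < i")
  case True
  then show ?thesis using assms parent_less[OF assms(1,2)]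
    by (auto simp: desc_def block_parent)
next
  case False
  then have "f i < i" "i < c" using assms by (auto simp: valid_parents_def)
  then show ?thesis by (auto simp: desc_def)
qed

lemma desc_ge: "i \<in> desc f n c \<Longrightarrow> c \<le> i"
  using block_le_self[of f c i] by (auto simp: desc_def)

lemma desc_self: "c \<in> {1..n} \<Longrightarrow> c \<in> desc f n c"
  by (auto simp: desc_def)

text \<open>Only the edge above \<open>c\<close> leaves the subtree of \<open>c\<close>, because membership of this subtree passes between
  every other vertex and its parent (\<open>desc_parent\<close>).\<close>

lemma desc_bridge:
  assumes "valid_parents n f" "c \<in> {2..n}" "{x, y} \<in> edges (tree_of n f)"
    "x \<in> desc f n c" "y \<notin> desc f n c"
  shows "x = c \<and> y = f c"
proof -
  obtain i where i: "i \<in> {2..n}" "{x, y} = {f i, i}"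
    using assms(3) by (auto simp: tree_of_def)
  then have "i = c" using desc_parent[OF assms(1) i(1), of c] assms
    by (auto simp: doubleton_eq_iff)
  moreover have "f c \<notin> desc f n c"
    using desc_ge[of "f c" f n c] parent_less[OF assms(1,2)] by auto
  ultimately show ?thesis using i assms desc_self[of c n f] by (auto simp: doubleton_eq_iff)
qed

lemma parent_notin_desc:
  assumes "valid_parents n f" "c \<in> {2..n}"
  shows "f c \<in> {1..n} - desc f n c"
  using desc_ge[of "f c" f n c] parent_less[OF assms] by auto

lemma desc_connected:
  assumes "valid_parents n f" "c \<in> {2..n}" "x \<in> desc f n c" "y \<in> desc f n c"
  shows "\<exists>p. is_path (tree_of n f) x p y \<and> set p \<subseteq> desc f n c"
proof -
  have "\<exists>p. is_path (tree_of n f) x p y \<and> set p \<subseteq> desc f n c \<inter> {..max x y}"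
  proof (rule parent_closed_connected[where r = c])
    show "desc f n c \<subseteq> {1..n}" by (auto simp: desc_def)
    fix i assume i: "i \<in> desc f n c" "i \<noteq> c"
    then have "i \<in> {2..n}" using desc_ge[OF i(1)] assms by (auto simp: desc_def)
    then show "i \<in> {2..n} \<and> f i \<in> desc f n c \<and> f i < i"
      using desc_parent[OF assms(1), of i c] i assms by (auto simp: valid_parents_def)
  qed (use assms desc_ge in blast)+
  then show ?thesis by blast
qed

lemma desc_compl_connected:
  assumes "valid_parents n f" "c \<in> {2..n}" "x \<in> {1..n} - desc f n c" "y \<in> {1..n} - desc f n c"
  shows "\<exists>p. is_path (tree_of n f) x p y \<and> set p \<subseteq> {1..n} - desc f n c"
proof -
  have "\<exists>p. is_path (tree_of n f) x p y \<and> set p \<subseteq> ({1..n} - desc f n c) \<inter> {..max x y}"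
  proof (rule parent_closed_connected[where r = 1])
    fix i assume i: "i \<in> {1..n} - desc f n c" "i \<noteq> 1"
    then have "i \<in> {2..n}" "i \<noteq> c" using desc_self[of c n f] assms by auto
    then show "i \<in> {2..n} \<and> f i \<in> {1..n} - desc f n c \<and> f i < i"
      using desc_parent[OF assms(1), of i c] i assms parent_less[OF assms(1), of i]
      by (auto simp: valid_parents_def)
  qed (use assms in auto)
  then show ?thesis by blast
qed

lemma subtree_from_parent:
  assumes "valid_parents n f" "c \<in> {2..n}"
  shows "subtree (tree_of n f) (f c) c = desc f n c"
proof (rule subtree_across_bridge[where A = "{1..n} - desc f n c"])
  show "\<exists>p. is_path (tree_of n f) c p w \<and> set p \<subseteq> desc f n c" if "w \<in> desc f n c" for w
    using desc_connected[OF assms _ that, of c] desc_self[of c n f] assms by auto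
  show "y = f c" if "x \<in> desc f n c" "y \<in> {1..n} - desc f n c" "{x, y} \<in> edges (tree_of n f)" for x y
    using desc_bridge[OF assms that(3)] that by auto
  show "c \<in> desc f n c" using assms by (simp add: desc_self)
  show "f c \<in> {1..n} - desc f n c" by (rule parent_notin_desc[OF assms])
  show "{f c, c} \<in> edges (tree_of n f)" using assms by (auto simp: tree_of_def)
  show "verts (tree_of n f) = ({1..n} - desc f n c) \<union> desc f n c"
    by (auto simp: tree_of_def desc_def)
qed auto

lemma subtree_from_child:
  assumes "valid_parents n f" "c \<in> {2..n}"
  shows "subtree (tree_of n f) c (f c) = {1..n} - desc f n c"
proof (rule subtree_across_bridge[where A = "desc f n c"])
  show "\<exists>p. is_path (tree_of n f) (f c) p w \<and> set p \<subseteq> {1..n} - desc f n c"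
    if "w \<in> {1..n} - desc f n c" for w
    using desc_compl_connected[OF assms _ that, of "f c"] parent_notin_desc[OF assms] by auto
  show "y = c" if "x \<in> {1..n} - desc f n c" "y \<in> desc f n c" "{x, y} \<in> edges (tree_of n f)" for x y
    using desc_bridge[OF assms, of y x] that by (auto simp: insert_commute)
  show "c \<in> desc f n c" using assms by (simp add: desc_self)
  show "f c \<in> {1..n} - desc f n c" by (rule parent_notin_desc[OF assms])
  show "{c, f c} \<in> edges (tree_of n f)" using assms by (auto simp: tree_of_def)
  show "verts (tree_of n f) = desc f n c \<union> ({1..n} - desc f n c)"
    by (auto simp: tree_of_def desc_def)
qed auto

lemma neighbors_tree_of:
  assumes "valid_parents n f" "v \<in> {1..n}"
  shows "neighbors (tree_of n f) v = (if v = 1 then {} else {f v}) \<union> {c\<in>{2..n}. f c = v}"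
proof -
  have "f c < c \<and> f c \<in> {1..n}" if "c \<in> {2..n}" for c
    using assms(1) that parent_less[OF assms(1) that] by (auto simp: valid_parents_def)
  then show ?thesis
    using assms(2) by (auto simp: neighbors_def tree_of_def doubleton_eq_iff image_iff; force)
qed

lemma card_subtree_from_child:
  assumes "valid_parents n f" "c \<in> {2..n}"
  shows "card (subtree (tree_of n f) c (f c)) = n - desc_count f n c"
proof -
  have "desc f n c \<subseteq> {1..n}" by (auto simp: desc_def)
  then show ?thesis by (simp add: subtree_from_child[OF assms] card_Diff_subset finite_subset)
qed

lemma centrality_le_desc:
  assumes "valid_parents n f" "v \<in> {2..n}"
  shows "jordan_centrality (tree_of n f) v \<le> desc_count f n v"
  unfolding jordan_centrality_def
  using assms neighbors_tree_of[OF assms(1), of v]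
  by (intro Min_le) (auto simp: subtree_from_parent[OF assms])

lemma centrality_one_le:
  assumes "valid_parents n f" "2 \<le> n"
  shows "jordan_centrality (tree_of n f) 1 \<le> n - desc_count f n 2"
proof -
  have f2: "f 2 = 1" using parent_less[OF assms(1), of 2] assms(2) by simp
  then have "n - desc_count f n 2 = card (subtree (tree_of n f) 2 1)"
    using card_subtree_from_child[OF assms(1), of 2] assms by simp
  then show ?thesis
    unfolding jordan_centrality_def
    using assms neighbors_tree_of[OF assms(1), of 1] f2 by (intro Min_le) auto
qed

text \<open>Vertex \<open>2\<close> is always attached to the root, so the edge between \<open>1\<close> and \<open>2\<close> splits the tree into the two
  blocks of time \<open>2\<close>.\<close>

lemma complement_two_eq_mass:
  assumes "valid_parents n f"
  shows "n - desc_count f n 2 = mass f 2 {1} n"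
proof -
  have "{1..n} - desc f n 2 = {i\<in>{1..n}. block f 2 i \<in> {1}}"
    using block_range[OF assms, of _ 2] by (force simp: desc_def)
  moreover have "card ({1..n} - desc f n 2) = n - desc_count f n 2"
    by (subst card_Diff_subset) (auto simp: desc_def)
  ultimately show ?thesis by (simp add: mass_def)
qed

text \<open>The root has no parent edge, and its descendant count carries no information. Starting the urn at
  time \<open>max v 2\<close> treats it on a par with the other vertices: it uses the edge from \<open>1\<close> to \<open>2\<close> in place of
  the parent edge.\<close>

lemma centrality_le_mass:
  assumes f: "valid_parents n f" and v: "v \<in> {1..n}" and n: "2 \<le> n"
  shows "jordan_centrality (tree_of n f) v \<le> mass f (max v 2) {v} n"
proof (cases "v = 1")
  case True
  then have "max v 2 = 2" by simp
  then show ?thesis using True centrality_one_le[OF f n] complement_two_eq_mass[OF f] by metis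
next
  case False
  then have "v \<in> {2..n}" "max v 2 = v" using v by auto
  then show ?thesis using centrality_le_desc[OF f] by (simp only: desc_count_eq_mass)
qed

text \<open>The two hypotheses are the two kinds of neighbours, the parent and the children.\<close>

lemma centrality_greaterI:
  assumes "valid_parents n f" "v \<in> {1..n}" "2 \<le> n"
    and "v \<noteq> 1 \<Longrightarrow> z < desc_count f n v"
    and "\<And>c. c \<in> {2..n} \<Longrightarrow> f c = v \<Longrightarrow> z < n - desc_count f n c"
  shows "z < jordan_centrality (tree_of n f) v"
proof -
  let ?N = "neighbors (tree_of n f) v"
  have N: "?N = (if v = 1 then {} else {f v}) \<union> {c\<in>{2..n}. f c = v}"
    using neighbors_tree_of assms by blast
  have "2 \<in> ?N" if "v = 1"
  proof -
    have "f 2 = 1" using parent_less[OF assms(1), of 2] assms(3) by simp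
    then show ?thesis using that assms(3) N by simp
  qed
  then have ne: "?N \<noteq> {}" using N by auto
  have fin: "finite ?N" using N by auto
  have "z < card (subtree (tree_of n f) u v)" if u: "u \<in> ?N" for u
  proof (cases "u \<in> {2..n} \<and> f u = v")
    case True
    then show ?thesis using card_subtree_from_child[OF assms(1), of u] assms(5) by auto
  next
    case False
    then have "v \<noteq> 1" "u = f v" using u N by (auto split: if_splits)
    then show ?thesis using subtree_from_parent[OF assms(1), of v] assms(2,4) by auto
  qed
  then show ?thesis unfolding jordan_centrality_def using fin ne by auto
qed

text \<open>The far side of an edge at \<open>u\<close> cannot swallow both blocks: the side of \<open>u\<close> contains the whole block of
  \<open>u\<close> if the edge leaves this block, and the whole block of \<open>w\<close> if the edge stays inside the block of \<open>u\<close>.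
  This turns large blocks into large centralities without asking whether a child of \<open>u\<close> carries most of
  the tree.\<close>

lemma centrality_two_blocks:
  assumes f: "valid_parents n f" and uw: "u \<in> {1..M}" "w \<in> {1..M}" "u \<noteq> w" "M \<le> n"
    and z: "z < mass f M {u} n" "z < mass f M {w} n"
  shows "z < jordan_centrality (tree_of n f) u"
proof (rule centrality_greaterI[OF f])
  show "u \<in> {1..n}" "2 \<le> n" using uw by auto
  have "{i\<in>{1..n}. block f M i \<in> {u}} \<subseteq> desc f n u"
  proof
    fix i assume i: "i \<in> {i\<in>{1..n}. block f M i \<in> {u}}"
    then have "block f u i = block f u u" using block_block[of u M f i] uw by simp
    then show "i \<in> desc f n u" using i by (simp add: desc_def)
  qed
  then have "mass f M {u} n \<le> desc_count f n u"
    unfolding mass_def by (intro card_mono) (auto simp: desc_def)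
  then show "z < desc_count f n u" using z by simp
  fix c assume c: "c \<in> {2..n}" "f c = u"
  have uc: "u < c" using f c by (auto simp: valid_parents_def)
  have "\<exists>x\<in>{u, w}. {i\<in>{1..n}. block f M i \<in> {x}} \<subseteq> {1..n} - desc f n c"
  proof (cases "c \<le> M")
    case True
    have "i \<notin> desc f n c" if "block f M i = u" for i
      using block_block[OF True, of f i] that uc by (auto simp: desc_def)
    then show ?thesis by auto
  next
    case False
    then have "block f M c = u" using block_parent[OF f c(1), of M] c uw by auto
    then have "i \<notin> desc f n c" if "block f M i = w" for i
      using block_block[of M c f i] that uw False by (auto simp: desc_def)
    then show ?thesis by auto
  qed
  then obtain x where x: "x \<in> {u, w}" "{i\<in>{1..n}. block f M i \<in> {x}} \<subseteq> {1..n} - desc f n c" by blast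
  have "mass f M {x} n \<le> card ({1..n} - desc f n c)"
    unfolding mass_def using x(2) by (intro card_mono) auto
  also have "\<dots> = n - desc_count f n c"
    using card_subtree_from_child[OF f c(1)] subtree_from_child[OF f c(1)] by simp
  finally show "z < n - desc_count f n c" using x z by auto
qed

lemma centrality_large_blocks:
  assumes f: "valid_parents n f" and M: "M \<le> n"
    and G: "G \<subseteq> {u\<in>{1..M}. z < mass f M {u} n}" "2 \<le> card G" and u: "u \<in> G"
  shows "z < jordan_centrality (tree_of n f) u"
proof -
  have "G \<noteq> {u}" using G(2) by auto
  then obtain w where w: "w \<in> G" "w \<noteq> u" using u by blast
  show ?thesis by (rule centrality_two_blocks[OF f, of u M w]) (use G u w M in auto)
qed


section \<open>Rankings\<close>

text \<open>All vertices ranked no later than \<open>v\<close> have at least the score of \<open>v\<close>. Together with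
  \<open>card_rank_greater\<close> this confines the rank whatever way ties are broken.\<close>

lemma card_rank_le:
  assumes "\<sigma> \<in> rankings V \<phi>" "finite V" "v \<in> V"
  shows "\<sigma> v \<le> card {u\<in>V. \<phi> v \<le> \<phi> u}"
proof -
  have b: "bij_betw \<sigma> V {1..card V}" using assms by (simp add: rankings_def)
  have v: "\<sigma> v \<in> {1..card V}" using b assms by (auto simp: bij_betw_def)
  have "{1..\<sigma> v} \<subseteq> \<sigma> ` {u\<in>V. \<phi> v \<le> \<phi> u}"
  proof
    fix j assume j: "j \<in> {1..\<sigma> v}"
    then have "j \<in> \<sigma> ` V" using b v by (auto simp: bij_betw_def)
    then obtain u where u: "u \<in> V" "\<sigma> u = j" by blast
    have "\<phi> u < \<phi> v \<Longrightarrow> \<sigma> v < \<sigma> u"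
      using assms(1,3) u(1) unfolding rankings_def by blast
    then have "\<not> \<phi> u < \<phi> v" using j u by auto
    then show "j \<in> \<sigma> ` {u\<in>V. \<phi> v \<le> \<phi> u}" using u by auto
  qed
  then have "card {1..\<sigma> v} \<le> card {u\<in>V. \<phi> v \<le> \<phi> u}"
    using assms by (intro surj_card_le) auto
  then show ?thesis by simp
qed

lemma card_rank_greater:
  assumes "\<sigma> \<in> rankings V \<phi>" "finite V" "v \<in> V"
  shows "card {u\<in>V. \<phi> v < \<phi> u} < \<sigma> v"
proof -
  have b: "bij_betw \<sigma> V {1..card V}" using assms by (simp add: rankings_def)
  have v: "\<sigma> v \<in> {1..card V}" using b assms by (auto simp: bij_betw_def)
  have "\<sigma> ` {u\<in>V. \<phi> v < \<phi> u} \<subseteq> {1..<\<sigma> v}"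
  proof
    fix j assume "j \<in> \<sigma> ` {u\<in>V. \<phi> v < \<phi> u}"
    then obtain u where u: "u \<in> V" "\<phi> v < \<phi> u" "j = \<sigma> u" by blast
    then have "\<sigma> u < \<sigma> v" using assms by (simp add: rankings_def)
    moreover have "\<sigma> u \<in> {1..card V}" using b u by (auto simp: bij_betw_def)
    ultimately show "j \<in> {1..<\<sigma> v}" using u by simp
  qed
  moreover have "inj_on \<sigma> {u\<in>V. \<phi> v < \<phi> u}"
    using b by (auto simp: bij_betw_def inj_on_def)
  ultimately have "card {u\<in>V. \<phi> v < \<phi> u} \<le> card {1..<\<sigma> v}"
    using card_inj_on_le by blast
  then show ?thesis using v by auto
qed

lemma rank_range:
  assumes "\<sigma> \<in> rankings V \<phi>" "v \<in> V"
  shows "\<sigma> v \<in> {1..card V}"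
  using assms by (auto simp: rankings_def bij_betw_def)

text \<open>The deterministic input of both bounds that need many vertices ahead of \<open>v\<close>.\<close>

lemma rank_greater_if_large_blocks:
  assumes f: "valid_parents n f" and v: "v \<in> {1..n}" and M: "M \<le> n"
    and G: "G \<subseteq> {u\<in>{1..M}. z < mass f M {u} n}" "2 \<le> card G"
    and z: "jordan_centrality (tree_of n f) v \<le> z"
    and \<sigma>: "\<sigma> \<in> rankings {1..n} (jordan_centrality (tree_of n f))"
  shows "card G < \<sigma> v"
proof -
  have "G \<subseteq> {u\<in>{1..n}. jordan_centrality (tree_of n f) v < jordan_centrality (tree_of n f) u}"
    using centrality_large_blocks[OF f M G] z G(1) M by fastforce
  then have "card G \<le> card {u\<in>{1..n}. jordan_centrality (tree_of n f) v < jordan_centrality (tree_of n f) u}"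
    by (intro card_mono) auto
  then show ?thesis using card_rank_greater[OF \<sigma> _ v] by simp
qed


section \<open>Finitely supported expectations\<close>

abbreviation expect :: "'a pmf \<Rightarrow> ('a \<Rightarrow> real) \<Rightarrow> real" where
  "expect p h \<equiv> measure_pmf.expectation p h"

lemma expect_finite:
  "finite (set_pmf p) \<Longrightarrow> expect p h = (\<Sum>x\<in>set_pmf p. h x * pmf p x)"
  by (rule integral_measure_pmf_real) auto

lemma expect_mono:
  "finite (set_pmf p) \<Longrightarrow> (\<And>x. x \<in> set_pmf p \<Longrightarrow> h x \<le> h' x) \<Longrightarrow> expect p h \<le> expect p h'"
  by (simp add: expect_finite sum_mono mult_right_mono)

lemma expect_cong:
  "(\<And>x. x \<in> set_pmf p \<Longrightarrow> h x = h' x) \<Longrightarrow> expect p h = expect p h'"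
  by (intro integral_cong_AE) (auto simp: AE_measure_pmf_iff)

lemma expect_add:
  "finite (set_pmf p) \<Longrightarrow> expect p (\<lambda>x. h x + h' x) = expect p h + expect p h'"
  by (simp add: expect_finite sum.distrib ring_distribs)

lemma expect_diff:
  "finite (set_pmf p) \<Longrightarrow> expect p (\<lambda>x. h x - h' x) = expect p h - expect p h'"
  by (simp add: expect_finite sum_subtractf ring_distribs)

lemma expect_sum:
  "finite (set_pmf p) \<Longrightarrow> expect p (\<lambda>x. \<Sum>i\<in>I. h i x) = (\<Sum>i\<in>I. expect p (h i))"
  by (simp add: expect_finite sum_distrib_right sum.swap[of _ I])

lemma expect_bind:
  assumes "finite (set_pmf p)" "\<And>x. x \<in> set_pmf p \<Longrightarrow> finite (set_pmf (k x))"
  shows "expect (bind_pmf p k) h = expect p (\<lambda>x. expect (k x) h)"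
proof -
  have "expect (bind_pmf p k) h = (\<Sum>a\<in>set_pmf p. pmf p a *\<^sub>R expect (k a) h)"
    using assms by (intro pmf_expectation_bind) auto
  then show ?thesis using assms by (simp add: expect_finite[of p] mult.commute)
qed

lemma prob_eq_expect: "measure_pmf.prob p {x. P x} = expect p (\<lambda>x. of_bool (P x))"
proof -
  have "(\<lambda>x. of_bool (P x)) = indicat_real {x. P x}" by (auto simp: indicator_def)
  then show ?thesis by simp
qed

lemma expect_disj_le:
  "finite (set_pmf p) \<Longrightarrow>
   expect p (\<lambda>x. of_bool (P x \<or> Q x)) \<le> expect p (\<lambda>x. of_bool (P x)) + expect p (\<lambda>x. of_bool (Q x))"
  by (subst expect_add[symmetric]) (auto intro!: expect_mono)

lemma expect_ex_le:
  assumes "finite (set_pmf p)" "finite I"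
  shows "expect p (\<lambda>x. of_bool (\<exists>i\<in>I. P i x)) \<le> (\<Sum>i\<in>I. expect p (\<lambda>x. of_bool (P i x)))"
proof -
  have "of_bool (\<exists>i\<in>I. P i x) \<le> (\<Sum>i\<in>I. of_bool (P i x) :: real)" for x
  proof (cases "\<exists>i\<in>I. P i x")
    case True
    then obtain i where i: "i \<in> I" "P i x" by blast
    then have "(of_bool (P i x) :: real) \<le> (\<Sum>i\<in>I. of_bool (P i x))"
      using assms(2) by (intro member_le_sum) auto
    then show ?thesis using True i by simp
  qed (simp add: sum_nonneg)
  then have "expect p (\<lambda>x. of_bool (\<exists>i\<in>I. P i x)) \<le> expect p (\<lambda>x. \<Sum>i\<in>I. of_bool (P i x))"
    using assms by (intro expect_mono) auto
  then show ?thesis unfolding expect_sum[OF assms(1)] .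
qed


section \<open>Growing a random parent function\<close>

text \<open>Extends the parent function \<open>f\<close> of a tree with \<open>m\<close> vertices by \<open>k\<close> uniformly attached vertices. Keeping
  the starting point explicit makes conditioning on the tree at time \<open>m\<close> a matter of composing kernels
  (\<open>expect_grow_split\<close>).\<close>

primrec grow :: "nat \<Rightarrow> nat \<Rightarrow> (nat \<Rightarrow> nat) \<Rightarrow> (nat \<Rightarrow> nat) pmf" where
  "grow m 0 f = return_pmf f"
| "grow m (Suc k) f =
     bind_pmf (grow m k f) (\<lambda>g. map_pmf (\<lambda>u. g(Suc (m + k) := u)) (pmf_of_set {1..m + k}))"

lemma finite_grow [simp]: "1 \<le> m \<Longrightarrow> finite (set_pmf (grow m k f))"
  by (induction k) auto

lemma expect_grow_Suc:
  assumes "1 \<le> m"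
  shows "expect (grow m (Suc k) f) h =
    expect (grow m k f) (\<lambda>g. (\<Sum>u\<in>{1..m + k}. h (g(Suc (m + k) := u))) / real (m + k))"
  using assms by (simp add: expect_bind integral_pmf_of_set)

lemma grow_add: "grow m (j + k) f = bind_pmf (grow m j f) (grow (m + j) k)"
  by (induction k) (simp_all add: bind_return_pmf' bind_assoc_pmf add.assoc)

lemma grow_split:
  assumes "m \<le> M" "M \<le> n"
  shows "grow m (n - m) f = bind_pmf (grow m (M - m) f) (grow M (n - M))"
  using grow_add[of m "M - m" "n - M" f] assms by simp

lemma expect_grow_split:
  assumes "1 \<le> m" "m \<le> M" "M \<le> n"
  shows "expect (grow m (n - m) f) h =
    expect (grow m (M - m) f) (\<lambda>g. expect (grow M (n - M) g) h)"
  using assms by (simp add: grow_split[OF assms(2,3)] expect_bind)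

lemma grow_support:
  assumes "valid_parents m f" "1 \<le> m" "g \<in> set_pmf (grow m k f)"
  shows "valid_parents (m + k) g \<and> (\<forall>i\<le>m. g i = f i)"
  using assms(3)
proof (induction k arbitrary: g)
  case 0
  then show ?case using assms by simp
next
  case (Suc k)
  then obtain g' u where "g' \<in> set_pmf (grow m k f)" "u \<in> {1..m + k}" "g = g'(Suc (m + k) := u)"
    using assms by (auto simp: set_pmf_of_set)
  then show ?case using Suc.IH[of g'] by (auto simp: valid_parents_def le_Suc_eq)
qed

lemma grow_valid:
  assumes "valid_parents m f" "1 \<le> m" "m \<le> n" "g \<in> set_pmf (grow m (n - m) f)"
  shows "valid_parents n g" "\<And>i. i \<le> m \<Longrightarrow> g i = f i"
  using grow_support[OF assms(1,2,4)] assms(3) by auto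

text \<open>Vertex \<open>1\<close> has no parent; the initial function supplies \<open>0\<close> as a default value.\<close>

definition random_parents :: "nat \<Rightarrow> (nat \<Rightarrow> nat) pmf" where
  "random_parents n = grow 1 (n - 1) (\<lambda>_. 0)"

lemma finite_random_parents [simp]: "finite (set_pmf (random_parents n))"
  by (simp add: random_parents_def)

lemma random_parents_valid: "1 \<le> n \<Longrightarrow> f \<in> set_pmf (random_parents n) \<Longrightarrow> valid_parents n f"
  unfolding random_parents_def by (rule grow_valid(1)[of 1 "\<lambda>_. 0"]) (auto simp: valid_parents_def)

lemma expect_random_parents_split:
  "1 \<le> m \<Longrightarrow> m \<le> n \<Longrightarrow> expect (random_parents n) h = expect (random_parents m) (\<lambda>f. expect (grow m (n - m) f) h)"
  unfolding random_parents_def by (rule expect_grow_split) auto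

lemma recursive_tree_eq_random_parents:
  assumes "1 \<le> n"
  shows "recursive_tree n = map_pmf (tree_of n) (random_parents n)"
proof -
  have "recursive_tree (Suc k) = map_pmf (tree_of (Suc k)) (grow 1 k (\<lambda>_. 0))" for k
  proof (induction k)
    case 0
    then show ?case by (simp add: tree_of_def)
  next
    case (Suc k)
    have step: "tree_of (Suc (Suc k)) (g(Suc (Suc k) := u)) =
      (insert (Suc (Suc k)) {1..Suc k}, insert {u, Suc (Suc k)} ((\<lambda>i. {g i, i}) ` {2..Suc k}))" for g u
    proof -
      have "{2..Suc (Suc k)} = insert (Suc (Suc k)) {2..Suc k}" by auto
      then have "(\<lambda>i. {(g(Suc (Suc k) := u)) i, i}) ` {2..Suc (Suc k)} =
        insert {u, Suc (Suc k)} ((\<lambda>i. {(g(Suc (Suc k) := u)) i, i}) ` {2..Suc k})" by simp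
      also have "(\<lambda>i. {(g(Suc (Suc k) := u)) i, i}) ` {2..Suc k} = (\<lambda>i. {g i, i}) ` {2..Suc k}"
        by (intro image_cong) auto
      finally show ?thesis by (auto simp: tree_of_def)
    qed
    show ?case
      by (simp add: Suc map_bind_pmf bind_map_pmf map_pmf_def[of _ "pmf_of_set _"] bind_assoc_pmf
          bind_return_pmf step) (simp add: tree_of_def map_pmf_def bind_return_pmf)
  qed
  from this[of "n - 1"] assms show ?thesis by (simp add: random_parents_def)
qed


section \<open>Block masses and the Polya urn\<close>

text \<open>The conditional expectation of \<open>h\<close> after one draw, when \<open>a\<close> of the \<open>n\<close> balls have the colour in question.
  The truncation at \<open>1\<close> keeps the weights a probability for all \<open>a\<close>, so that monotonicity of \<open>h\<close> is
  inherited with no restriction on the arguments.\<close>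

definition urn_step :: "nat \<Rightarrow> (nat \<Rightarrow> real) \<Rightarrow> nat \<Rightarrow> real" where
  "urn_step n h a = (let q = min 1 (real a / real n) in (1 - q) * h a + q * h (Suc a))"

text \<open>The expectation of \<open>h\<close> of the number of balls of one colour after \<open>k\<close> draws from an urn with \<open>m\<close> balls, as
  a function of the initial number of that colour.\<close>

primrec urn :: "nat \<Rightarrow> nat \<Rightarrow> (nat \<Rightarrow> real) \<Rightarrow> nat \<Rightarrow> real" where
  "urn m 0 h = h"
| "urn m (Suc k) h = urn m k (urn_step (m + k) h)"

lemma urn_step_antimono:
  assumes "antimono h"
  shows "antimono (urn_step n h)"
proof (rule decseq_SucI)
  fix a
  have h: "h (Suc a) \<le> h a" "h (Suc (Suc a)) \<le> h (Suc a)" using assms by (auto simp: antimono_def)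
  define q where "q = min 1 (real a / real n)"
  define q' where "q' = min 1 (real (Suc a) / real n)"
  have q: "0 \<le> q" "q \<le> 1" "0 \<le> q'" "q' \<le> 1" by (auto simp: q_def q'_def)
  have "urn_step n h (Suc a) = h (Suc a) + q' * (h (Suc (Suc a)) - h (Suc a))"
    unfolding urn_step_def Let_def q'_def[symmetric] by (simp add: algebra_simps)
  also have "\<dots> \<le> h (Suc a)" using h q by (simp add: mult_nonneg_nonpos)
  also have "\<dots> \<le> h (Suc a) + (1 - q) * (h a - h (Suc a))" using h q by simp
  also have "\<dots> = urn_step n h a" unfolding urn_step_def Let_def q_def[symmetric] by (simp add: algebra_simps)
  finally show "urn_step n h (Suc a) \<le> urn_step n h a" .
qed

lemma urn_antimono: "antimono h \<Longrightarrow> antimono (urn m k h)"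
  by (induction k arbitrary: h) (auto intro: urn_step_antimono)

lemma urn_step_nonneg: "(\<And>a. 0 \<le> h a) \<Longrightarrow> 0 \<le> urn_step n h a"
  by (auto simp: urn_step_def Let_def)

lemma urn_nonneg: "(\<And>a. 0 \<le> h a) \<Longrightarrow> 0 \<le> urn m k h a"
  by (induction k arbitrary: h) (auto intro: urn_step_nonneg)

lemma urn_linear:
  "urn m k (\<lambda>a. c * h a + d * h' a) x = c * urn m k h x + d * urn m k h' x"
proof (induction k arbitrary: h h')
  case (Suc k)
  have "urn_step (m + k) (\<lambda>a. c * h a + d * h' a) =
      (\<lambda>a. c * urn_step (m + k) h a + d * urn_step (m + k) h' a)"
    by (auto simp: urn_step_def Let_def algebra_simps)
  then show ?case by (simp add: Suc)
qed simp

lemma urn_const: "urn m k (\<lambda>_. c) = (\<lambda>_. c)"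
proof (induction k)
  case (Suc k)
  have "urn_step (m + k) (\<lambda>_. c) = (\<lambda>_. c)" by (auto simp: urn_step_def Let_def algebra_simps)
  then show ?case using Suc by simp
qed simp

lemma sum_shift_indicator:
  fixes h :: "nat \<Rightarrow> real"
  assumes "finite U"
  shows "(\<Sum>u\<in>U. h (a + of_bool (u \<in> B))) =
    real (card U) * h a + real (card (U \<inter> B)) * (h (Suc a) - h a)"
proof -
  have "(\<Sum>u\<in>U. h (a + of_bool (u \<in> B))) = (\<Sum>u\<in>U. h a + (if u \<in> B then h (Suc a) - h a else 0))"
    by (intro sum.cong) auto
  also have "\<dots> = real (card U) * h a + real (card (U \<inter> B)) * (h (Suc a) - h a)"
    using assms by (simp add: sum.distrib sum.inter_restrict[symmetric])
  finally show ?thesis .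
qed

lemma average_urn_step:
  assumes "1 \<le> n" "a = card ({1..n} \<inter> B)"
  shows "(\<Sum>u\<in>{1..n}. h (a + of_bool (u \<in> B))) / real n = urn_step n h a"
proof -
  have "a \<le> n" using card_mono[of "{1..n}" "{1..n} \<inter> B"] assms by simp
  then have q: "min 1 (real a / real n) = real a / real n" using assms by simp
  have "(\<Sum>u\<in>{1..n}. h (a + of_bool (u \<in> B))) = real n * h a + real a * (h (Suc a) - h a)"
    using sum_shift_indicator[of "{1..n}" h a B] assms(2) by simp
  then show ?thesis
    using assms(1) unfolding urn_step_def Let_def q by (simp add: field_simps)
qed

lemma mass_inter: "mass f m W n = card ({1..n} \<inter> {u. block f m u \<in> W})"
  unfolding mass_def by (intro arg_cong[where f = card]) auto

text \<open>The law of the mass of \<open>W\<close> depends on the tree at time \<open>m\<close> only through the number of vertices in \<open>W\<close>.\<close>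

lemma expect_mass:
  assumes "valid_parents m f" "1 \<le> m" "W \<subseteq> {1..m}"
  shows "expect (grow m k f) (\<lambda>g. h (mass g m W (m + k))) = urn m k h (card W)"
proof (induction k arbitrary: h)
  case 0
  then show ?case using mass_initial[OF assms(3)] by simp
next
  case (Suc k)
  have "expect (grow m (Suc k) f) (\<lambda>g. h (mass g m W (m + Suc k))) =
      expect (grow m k f) (\<lambda>g. urn_step (m + k) h (mass g m W (m + k)))"
    unfolding expect_grow_Suc[OF assms(2)]
  proof (rule expect_cong)
    fix g assume "g \<in> set_pmf (grow m k f)"
    then have g: "valid_parents (m + k) g" using grow_support assms by blast
    have "(\<Sum>u\<in>{1..m + k}. h (mass (g(Suc (m + k) := u)) m W (m + Suc k))) =
        (\<Sum>u\<in>{1..m + k}. h (mass g m W (m + k) + of_bool (u \<in> {u. block g m u \<in> W})))"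
      using mass_step[OF g, of _ m W] by (intro sum.cong) auto
    then show "(\<Sum>u\<in>{1..m + k}. h (mass (g(Suc (m + k) := u)) m W (m + Suc k))) / real (m + k) =
        urn_step (m + k) h (mass g m W (m + k))"
      using average_urn_step[OF _ mass_inter, of "m + k" h g m W] assms(2) by simp
  qed
  then show ?case using Suc by simp
qed

text \<open>Negative dependence for a single draw \<open>u\<close>. By induction on \<open>I\<close> it suffices to see that the factor of \<open>j\<close>
  and the product \<open>Y\<close> of the others are negatively correlated. The factor of \<open>j\<close> drops exactly when \<open>u\<close> hits
  \<open>B j\<close>; then \<open>u\<close> misses the other sets, and \<open>Y\<close> attains its maximal value \<open>y\<close>.\<close>

lemma average_prod_le:
  fixes h :: "'i \<Rightarrow> nat \<Rightarrow> real"
  assumes "finite I" "finite U" "U \<noteq> {}"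
    and "\<And>i j u. i \<in> I \<Longrightarrow> j \<in> I \<Longrightarrow> i \<noteq> j \<Longrightarrow> u \<in> B i \<Longrightarrow> u \<notin> B j"
    and "\<And>i. i \<in> I \<Longrightarrow> antimono (h i)" "\<And>i x. i \<in> I \<Longrightarrow> 0 \<le> h i x"
  shows "(\<Sum>u\<in>U. \<Prod>i\<in>I. h i (a i + of_bool (u \<in> B i))) / real (card U)
      \<le> (\<Prod>i\<in>I. (\<Sum>u\<in>U. h i (a i + of_bool (u \<in> B i))) / real (card U))"
  using assms(1,4-)
proof (induction I)
  case empty
  then show ?case using assms by simp
next
  case (insert j I)
  define Y where "Y u = (\<Prod>i\<in>I. h i (a i + of_bool (u \<in> B i)))" for u
  define Z where "Z u = h j (a j + of_bool (u \<in> B j))" for u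
  define y where "y = (\<Prod>i\<in>I. h i (a i))"
  define N where "N = real (card U)"
  define b where "b = real (card (U \<inter> B j))"
  define d where "d = h j (Suc (a j)) - h j (a j)"
  have N: "N > 0" using assms(2,3) by (simp add: N_def card_gt_0_iff)
  have d: "d \<le> 0" using insert.prems(2)[of j] by (simp add: d_def antimono_def)
  have Yy: "Y u = y" if "u \<in> B j" for u
    unfolding Y_def y_def using that insert.hyps insert.prems(1)[of j] by (intro prod.cong) auto
  have Y_le: "Y u \<le> y" for u
    unfolding Y_def y_def using insert.prems(2,3) by (intro prod_mono) (auto simp: antimono_def)
  \<comment> \<open>Where \<open>u\<close> hits \<open>B j\<close>, the factor \<open>Y u\<close> multiplying the drop \<open>d\<close> may be replaced by its maximum \<open>y\<close>.\<close>
  have "(\<Sum>u\<in>U. Z u * Y u) = (\<Sum>u\<in>U. h j (a j) * Y u + (if u \<in> B j then d * y else 0))"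
    by (intro sum.cong) (auto simp: Z_def d_def Yy algebra_simps)
  also have "\<dots> = h j (a j) * (\<Sum>u\<in>U. Y u) + b * (d * y)"
    using assms(2) by (simp add: sum.distrib sum.inter_restrict[symmetric] sum_distrib_left b_def)
  finally have ZY: "(\<Sum>u\<in>U. Z u * Y u) = h j (a j) * (\<Sum>u\<in>U. Y u) + b * (d * y)" .
  have sumZ: "(\<Sum>u\<in>U. Z u) = N * h j (a j) + b * d"
    unfolding Z_def sum_shift_indicator[OF assms(2)] by (simp add: N_def b_def d_def)
  have "(\<Sum>u\<in>U. Y u) \<le> (\<Sum>u\<in>U. y)" using Y_le by (intro sum_mono) auto
  then have avgY: "(\<Sum>u\<in>U. Y u) / N \<le> y" using N by (simp add: N_def field_simps)
  have "(\<Sum>u\<in>U. Z u * Y u) / N = h j (a j) * ((\<Sum>u\<in>U. Y u) / N) + b * d / N * y"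
    by (simp add: ZY add_divide_distrib)
  also have "\<dots> \<le> h j (a j) * ((\<Sum>u\<in>U. Y u) / N) + b * d / N * ((\<Sum>u\<in>U. Y u) / N)"
  proof -
    have "b * d / N \<le> 0" using d N by (simp add: b_def divide_nonpos_pos mult_nonneg_nonpos)
    then show ?thesis using avgY by (intro add_left_mono mult_left_mono_neg)
  qed
  also have "\<dots> = (\<Sum>u\<in>U. Z u) / N * ((\<Sum>u\<in>U. Y u) / N)"
    using N by (simp add: sumZ field_simps)
  also have "\<dots> \<le> (\<Sum>u\<in>U. Z u) / N * (\<Prod>i\<in>I. (\<Sum>u\<in>U. h i (a i + of_bool (u \<in> B i))) / N)"
  proof (rule mult_left_mono)
    show "(\<Sum>u\<in>U. Y u) / N \<le> (\<Prod>i\<in>I. (\<Sum>u\<in>U. h i (a i + of_bool (u \<in> B i))) / N)"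
      unfolding Y_def N_def using insert.prems by (intro insert.IH) auto
    show "0 \<le> (\<Sum>u\<in>U. Z u) / N"
      unfolding Z_def using N insert.prems(3) by (intro divide_nonneg_pos sum_nonneg) auto
  qed
  finally show ?case using insert.hyps by (simp add: Y_def Z_def N_def)
qed

text \<open>Averaging over the last draw replaces each \<open>h i\<close> by \<open>urn_step (m + k) (h i)\<close>, at the cost of an inequality
  in the right direction (\<open>average_prod_le\<close>); as \<open>urn_step\<close> preserves monotonicity and sign, this can be
  iterated down to time \<open>m\<close>.\<close>

lemma expect_prod_mass_le:
  assumes f: "valid_parents m f" "1 \<le> m" and I: "finite I"
    and W: "\<And>i. i \<in> I \<Longrightarrow> W i \<subseteq> {1..m}"
    and disj: "\<And>i j. i \<in> I \<Longrightarrow> j \<in> I \<Longrightarrow> i \<noteq> j \<Longrightarrow> W i \<inter> W j = {}"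
    and h: "\<And>i. i \<in> I \<Longrightarrow> antimono (h i)" "\<And>i x. i \<in> I \<Longrightarrow> 0 \<le> h i x"
  shows "expect (grow m k f) (\<lambda>g. \<Prod>i\<in>I. h i (mass g m (W i) (m + k)))
      \<le> (\<Prod>i\<in>I. urn m k (h i) (card (W i)))"
  using h
proof (induction k arbitrary: h)
  case 0
  have "(\<Prod>i\<in>I. h i (mass f m (W i) m)) = (\<Prod>i\<in>I. h i (card (W i)))"
    using mass_initial W by (intro prod.cong) auto
  then show ?case by simp
next
  case (Suc k)
  have "expect (grow m (Suc k) f) (\<lambda>g. \<Prod>i\<in>I. h i (mass g m (W i) (m + Suc k))) \<le>
      expect (grow m k f) (\<lambda>g. \<Prod>i\<in>I. urn_step (m + k) (h i) (mass g m (W i) (m + k)))"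
    unfolding expect_grow_Suc[OF f(2)]
  proof (rule expect_mono)
    fix g assume "g \<in> set_pmf (grow m k f)"
    then have g: "valid_parents (m + k) g" using grow_support f by blast
    let ?a = "\<lambda>i. mass g m (W i) (m + k)" and ?B = "\<lambda>i. {u. block g m u \<in> W i}"
    have avg: "(\<Sum>u\<in>{1..m + k}. \<Prod>i\<in>I. h i (mass (g(Suc (m + k) := u)) m (W i) (m + Suc k))) =
        (\<Sum>u\<in>{1..m + k}. \<Prod>i\<in>I. h i (?a i + of_bool (u \<in> ?B i)))"
      using mass_step[OF g, of _ m] by (intro sum.cong prod.cong) auto
    have "(\<Sum>u\<in>{1..m + k}. \<Prod>i\<in>I. h i (?a i + of_bool (u \<in> ?B i))) / real (card {1..m + k}) \<le>
        (\<Prod>i\<in>I. (\<Sum>u\<in>{1..m + k}. h i (?a i + of_bool (u \<in> ?B i))) / real (card {1..m + k}))"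
      using I f(2) Suc.prems disj by (intro average_prod_le) (force, force, force, blast, auto)
    also have "\<dots> = (\<Prod>i\<in>I. urn_step (m + k) (h i) (?a i))"
      using average_urn_step[OF _ mass_inter, of "m + k"] f(2) by (intro prod.cong) simp_all
    finally show "(\<Sum>u\<in>{1..m + k}. \<Prod>i\<in>I. h i (mass (g(Suc (m + k) := u)) m (W i) (m + Suc k)))
        / real (m + k) \<le> (\<Prod>i\<in>I. urn_step (m + k) (h i) (?a i))" unfolding avg by simp
  qed (use f in simp)
  also have "\<dots> \<le> (\<Prod>i\<in>I. urn m k (urn_step (m + k) (h i)) (card (W i)))"
    using Suc.prems by (intro Suc.IH urn_step_antimono urn_step_nonneg) auto
  finally show ?case by simp
qed


section \<open>The size distribution of a single block\<close>

text \<open>The probability that the block of a single vertex of time \<open>m \<ge> 2\<close> has more than \<open>z\<close> elements at time \<open>n\<close>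
  (\<open>urn_tail\<close>). At \<open>m = 1\<close> it is constantly \<open>1\<close>, which starts the recursion \<open>tail_Suc\<close>.\<close>

definition tail :: "nat \<Rightarrow> nat \<Rightarrow> nat \<Rightarrow> real" where
  "tail m n z = real ((n - 1 - z) choose (m - 1)) / real ((n - 1) choose (m - 1))"

text \<open>This is \<open>urn_step\<close> applied to the indicator of \<open>{z<..}\<close>, see \<open>urn_step_threshold\<close>.\<close>

lemma tail_recurrence:
  fixes m n z :: nat
  assumes "2 \<le> m" "m \<le> n"
  defines "q \<equiv> min 1 (real z / real n)"
  shows "tail m (Suc n) z = (1 - q) * tail m n z + q * tail m n (z - 1)"
proof (cases "z = 0 \<or> n < z")
  case True
  then show ?thesis using assms by (auto simp: tail_def q_def)
next
  case False
  define b where "b = n - z"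
  define j where "j = m - 1"
  have z: "real z = real n - real b" "z \<le> n" "1 \<le> z" using False by (auto simp: b_def)
  have absorb: "real b' * real ((b' - 1) choose j) = (real b' - real j) * real (b' choose j)" for b'
  proof (cases "j \<le> b'")
    case True
    then show ?thesis using binomial_absorb_comp[of b' j]
      by (metis of_nat_diff of_nat_mult)
  next
    case False
    then show ?thesis by (simp add: binomial_eq_0)
  qed
  have pos: "real ((n - 1) choose j) > 0" "real (n choose j) > 0" "real n - real j > 0" "real n > 0"
    using assms by (auto simp: j_def)
  have q: "q = real z / real n" using z pos by (simp add: q_def)
  have ts: "tail m (Suc n) z = real (b choose j) / real (n choose j)"
    "tail m n z = real ((b - 1) choose j) / real ((n - 1) choose j)"
    "tail m n (z - 1) = real (b choose j) / real ((n - 1) choose j)"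
    using z by (auto simp: tail_def b_def j_def)
  have "(1 - q) * tail m n z + q * tail m n (z - 1) =
      (real b * real ((b - 1) choose j) + real z * real (b choose j)) / (real n * real ((n - 1) choose j))"
    unfolding ts q using pos by (simp add: z(1) field_simps)
  also have "\<dots> = ((real n - real j) * real (b choose j)) / ((real n - real j) * real (n choose j))"
    unfolding absorb by (simp add: z(1) algebra_simps)
  also have "\<dots> = tail m (Suc n) z" unfolding ts using pos by simp
  finally show ?thesis by simp
qed

lemma urn_step_threshold:
  "urn_step n (\<lambda>a. of_bool (z < a)) =
    (\<lambda>a. (1 - min 1 (real z / real n)) * of_bool (z < a) + min 1 (real z / real n) * of_bool (z - 1 < a))"
proof
  fix a
  consider "z < a" | "a = z" | "a < z" by linarith
  then show "urn_step n (\<lambda>a. of_bool (z < a)) a =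
    (1 - min 1 (real z / real n)) * of_bool (z < a) + min 1 (real z / real n) * of_bool (z - 1 < a)"
    by cases (cases "z = 0"; auto simp: urn_step_def Let_def)+
qed

lemma urn_tail:
  assumes "2 \<le> m"
  shows "urn m k (\<lambda>a. of_bool (z < a)) 1 = tail m (m + k) z"
proof (induction k arbitrary: z)
  case 0
  show ?case using assms by (cases z) (auto simp: tail_def binomial_eq_0)
next
  case (Suc k)
  then show ?case
    using tail_recurrence[OF assms, of "m + k" z] by (simp add: urn_step_threshold urn_linear)
qed

lemma tail_one [simp]: "tail 1 n z = 1" "tail (Suc 0) n z = 1"
  by (simp_all add: tail_def)

text \<open>Thus \<open>tail m n z\<close> is the product of the numbers \<open>1 - z / (n - i)\<close> for \<open>1 \<le> i < m\<close>, truncated at \<open>0\<close>. All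
  estimates of \<open>tail\<close> below compare these factors with a constant.\<close>

lemma tail_Suc:
  assumes "1 \<le> m" "m < n"
  shows "tail (Suc m) n z = tail m n z * max 0 (1 - real z / real (n - m))"
proof -
  define N where "N = n - 1"
  define j where "j = m - 1"
  have m: "m = Suc j" "Suc j \<le> N" using assms by (auto simp: j_def N_def)
  have c: "real (Suc j) * real (b choose Suc j) = real (b - j) * real (b choose j)" for b
    using binomial_absorption[of j b] binomial_absorb_comp[of b j] by (metis of_nat_mult)
  have b: "tail (Suc m) n z = real (N - z - j) * real ((N - z) choose j) / (real (N - j) * real (N choose j))"
    unfolding c[symmetric] using m by (simp add: tail_def N_def)
  have e1: "real (N - z - j) = real (N - j) * max 0 (1 - real z / real (N - j))"
    using m by (cases "z \<le> N - j") (auto simp: field_simps of_nat_diff max_def)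
  have e2: "n - m = N - j" using m by (auto simp: N_def)
  have e3: "tail m n z = real ((N - z) choose j) / real (N choose j)"
    by (simp add: tail_def N_def j_def)
  have "real (N - j) > 0" using m(2) by simp
  then show ?thesis unfolding b e1 e2 e3 by (simp add: field_simps)
qed

lemma tail_nonneg: "0 \<le> tail m n z"
  by (simp add: tail_def)

lemma tail_step_le:
  assumes "1 \<le> m" "m < n" "z \<le> n - 1"
  shows "tail (Suc m) n z \<le> tail m n z * (1 - real z / real (n - 1))"
proof -
  have "real z / real (n - 1) \<le> real z / real (n - m)"
    using assms by (intro divide_left_mono) auto
  moreover have "real z / real (n - 1) \<le> 1" using assms by (simp add: field_simps)
  ultimately show ?thesis
    unfolding tail_Suc[OF assms(1,2)] by (intro mult_left_mono tail_nonneg) auto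
qed

lemma tail_add_le:
  assumes "1 \<le> m" "m + j \<le> n" "z \<le> n - 1"
  shows "tail (m + j) n z \<le> tail m n z * (1 - real z / real (n - 1)) ^ j"
  using assms(2)
proof (induction j)
  case (Suc j)
  have r: "0 \<le> 1 - real z / real (n - 1)" using assms Suc by (simp add: field_simps)
  have "tail (Suc (m + j)) n z \<le> tail (m + j) n z * (1 - real z / real (n - 1))"
    using assms Suc by (intro tail_step_le) auto
  also have "\<dots> \<le> tail m n z * (1 - real z / real (n - 1)) ^ j * (1 - real z / real (n - 1))"
    using Suc r by (intro mult_right_mono) auto
  finally show ?case by (simp add: mult_ac)
qed simp

lemma tail_le_power:
  assumes "1 \<le> m" "m \<le> n" "z \<le> n - 1"
  shows "tail m n z \<le> (1 - real z / real (n - 1)) ^ (m - 1)"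
  using tail_add_le[of 1 "m - 1" n z] assms by simp

lemma tail_ge_power:
  assumes "1 \<le> m" "m \<le> n" "z \<le> n - m + 1"
  shows "(1 - real z / real (n - m + 1)) ^ (m - 1) \<le> tail m n z"
proof -
  define c where "c = 1 - real z / real (n - m + 1)"
  have c: "0 \<le> c" using assms by (simp add: c_def field_simps)
  have "c ^ j \<le> tail (Suc j) n z" if "Suc j \<le> m" for j
    using that
  proof (induction j)
    case (Suc j)
    have "c \<le> 1 - real z / real (n - Suc j)"
      unfolding c_def using Suc.prems assms by (intro diff_left_mono divide_left_mono) auto
    then have "c ^ j * c \<le> tail (Suc j) n z * max 0 (1 - real z / real (n - Suc j))"
      using Suc c by (intro mult_mono) (auto simp: tail_nonneg)
    then show ?case using tail_Suc[of "Suc j" n z] Suc.prems assms by (simp add: mult.commute)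
  qed simp
  from this[of "m - 1"] show ?thesis using assms by (simp add: c_def)
qed

lemma tail_le_1:
  assumes "1 \<le> m" "m \<le> n"
  shows "tail m n z \<le> 1"
proof -
  have "((n - 1 - z) choose (m - 1)) \<le> ((n - 1) choose (m - 1))"
    by (intro binomial_right_mono) auto
  then show ?thesis using assms by (simp add: tail_def)
qed

lemma one_minus_tail_le:
  assumes "2 \<le> m" "m \<le> n"
  shows "1 - tail m n z \<le> real z * real (m - 1) / real (n - m + 1)"
proof (cases "z \<le> n - m + 1")
  case True
  have "1 + real (m - 1) * (- (real z / real (n - m + 1))) \<le> (1 + (- (real z / real (n - m + 1)))) ^ (m - 1)"
    using True by (intro Bernoulli_inequality) (simp add: field_simps)
  also have "\<dots> \<le> tail m n z" using tail_ge_power[of m n z] True assms by simp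
  finally show ?thesis by (simp add: mult.commute)
next
  case False
  have "1 - tail m n z \<le> 1" by (simp add: tail_nonneg)
  also have "\<dots> \<le> real z / real (n - m + 1)" using False by (simp add: field_simps)
  also have "\<dots> \<le> real z / real (n - m + 1) * real (m - 1)"
    using mult_left_mono[of 1 "real (m - 1)" "real z / real (n - m + 1)"] assms by simp
  finally show ?thesis by (simp add: field_simps)
qed

text \<open>From \<open>(1 - x) ^ (m - 1) * (1 + x) ^ (m - 1) \<le> 1\<close> and Bernoulli's inequality.\<close>

lemma one_minus_tail_ge:
  assumes "1 \<le> m" "m \<le> n" "z \<le> n - 1" "2 \<le> n"
  defines "s \<equiv> real z * real (m - 1) / real (n - 1)"
  shows "s / (1 + s) \<le> 1 - tail m n z"
proof -
  define x where "x = real z / real (n - 1)"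
  have x: "0 \<le> x" "x \<le> 1" using assms by (auto simp: x_def)
  have s: "s = real (m - 1) * x" "0 \<le> s" by (auto simp: s_def x_def)
  have "(1 - x) ^ (m - 1) * (1 + s) \<le> (1 - x) ^ (m - 1) * (1 + x) ^ (m - 1)"
    using Bernoulli_inequality[of x "m - 1"] x unfolding s(1) by (intro mult_left_mono) auto
  also have "\<dots> = (1 - x\<^sup>2) ^ (m - 1)"
    by (simp add: power_mult_distrib[symmetric] algebra_simps power2_eq_square)
  also have "\<dots> \<le> 1" using x by (intro power_le_one) (auto simp: power_le_one)
  finally have "(1 - x) ^ (m - 1) \<le> 1 / (1 + s)" using s by (simp add: field_simps)
  then have "tail m n z \<le> 1 / (1 + s)" using tail_le_power[OF assms(1-3)] by (simp add: x_def)
  moreover have "1 - 1 / (1 + s) = s / (1 + s)" using s by (simp add: field_simps)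
  ultimately show ?thesis by linarith
qed

lemma one_minus_tail_lower:
  assumes "1 \<le> m" "m \<le> n" "z \<le> n - 1" "2 \<le> n" "real z * real (m - 1) / real (n - 1) \<le> 1"
  shows "real z * real (m - 1) / real (n - 1) / 2 \<le> 1 - tail m n z"
proof -
  define s where "s = real z * real (m - 1) / real (n - 1)"
  have s: "0 \<le> s" "s \<le> 1" using assms by (auto simp: s_def)
  then have "s / 2 \<le> s / (1 + s)" by (intro divide_left_mono) auto
  then show ?thesis using one_minus_tail_ge[OF assms(1-4)] by (simp add: s_def)
qed


section \<open>Joint estimates for block masses\<close>

lemma expect_threshold:
  assumes "valid_parents m f" "1 \<le> m" "m \<le> n" "W \<subseteq> {1..m}"
  shows "expect (grow m (n - m) f) (\<lambda>g. of_bool (z < mass g m W n)) =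
    urn m (n - m) (\<lambda>a. of_bool (z < a)) (card W)"
  using expect_mass[OF assms(1,2,4), of "n - m" "\<lambda>a. of_bool (z < a)"] assms(3) by simp

lemma expect_block_tail:
  assumes "valid_parents m f" "2 \<le> m" "m \<le> n" "v \<in> {1..m}"
  shows "expect (grow m (n - m) f) (\<lambda>g. of_bool (z < mass g m {v} n)) = tail m n z"
  using expect_threshold[of m f n "{v}" z] urn_tail[of m "n - m" z] assms by simp

lemma expect_block_small:
  assumes "valid_parents m f" "2 \<le> m" "m \<le> n" "v \<in> {1..m}"
  shows "expect (grow m (n - m) f) (\<lambda>g. of_bool (mass g m {v} n \<le> z)) = 1 - tail m n z"
proof -
  have "expect (grow m (n - m) f) (\<lambda>g. of_bool (mass g m {v} n \<le> z)) =
      expect (grow m (n - m) f) (\<lambda>g. 1 - of_bool (z < mass g m {v} n))"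
    by (intro expect_cong) (auto simp: not_less)
  then show ?thesis using expect_block_tail[OF assms] assms(2) by (simp add: expect_diff)
qed

lemma urn_le_threshold:
  "urn m k (\<lambda>a. of_bool (a \<le> z)) a = 1 - urn m k (\<lambda>a. of_bool (z < a)) a"
proof -
  have "(\<lambda>a. of_bool (a \<le> z)) = (\<lambda>a. 1 * 1 + (- 1) * (of_bool (z < a) :: real))"
    by (auto simp: not_less)
  then show ?thesis using urn_linear[of m k 1 "\<lambda>_. 1" "- 1"] by (simp add: urn_const)
qed

lemma antimono_le_threshold: "antimono (\<lambda>a::nat. of_bool (a \<le> z) :: real)"
  by (auto simp: antimono_def)

lemma urn_threshold_nonneg: "0 \<le> urn m k (\<lambda>a. of_bool (z < a)) a"
  by (rule urn_nonneg) simp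

lemma urn_threshold_mono: "a \<le> b \<Longrightarrow> urn m k (\<lambda>a. of_bool (z < a)) a \<le> urn m k (\<lambda>a. of_bool (z < a)) b"
  using antimonoD[OF urn_antimono[OF antimono_le_threshold], of a b m k z] by (simp add: urn_le_threshold)

lemma of_bool_prod:
  "finite I \<Longrightarrow> (\<Prod>i\<in>I. of_bool (P i)) = (of_bool (\<forall>i\<in>I. P i) :: real)"
  by (induction I rule: finite_induct) auto

lemma expect_all_blocks_small_le:
  assumes f: "valid_parents m f" "2 \<le> m" "m \<le> n" and I: "I \<subseteq> {1..m}"
  shows "expect (grow m (n - m) f) (\<lambda>g. of_bool (\<forall>i\<in>I. mass g m {i} n \<le> z)) \<le> (1 - tail m n z) ^ card I"
proof -
  have fin: "finite I" using I finite_subset by blast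
  have "expect (grow m (n - m) f) (\<lambda>g. \<Prod>i\<in>I. of_bool (mass g m {i} (m + (n - m)) \<le> z)) \<le>
      (\<Prod>i\<in>I. urn m (n - m) (\<lambda>a. of_bool (a \<le> z)) (card {i}))"
    using assms fin
    by (intro expect_prod_mass_le[where W = "\<lambda>i. {i}" and h = "\<lambda>_ a. of_bool (a \<le> z)"])
       (auto simp: antimono_le_threshold)
  also have "\<dots> = (1 - tail m n z) ^ card I"
    using urn_tail[OF f(2), of "n - m" z] f(3) by (simp add: urn_le_threshold)
  finally show ?thesis using fin f(3) by (simp add: of_bool_prod)
qed

text \<open>A union bound over the sets of \<open>j\<close> small blocks; \<open>2 ^ M\<close> is a crude bound for their number.\<close>

lemma expect_many_small_blocks_le:
  assumes f: "valid_parents M f" "2 \<le> M" "M \<le> n"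
  shows "expect (grow M (n - M) f) (\<lambda>g. of_bool (j \<le> card {u\<in>{1..M}. mass g M {u} n \<le> z}))
    \<le> 2 ^ M * (1 - tail M n z) ^ j"
proof -
  let ?p = "grow M (n - M) f"
  let ?\<I> = "{I. I \<subseteq> {1..M} \<and> card I = j}"
  have fin: "finite (set_pmf ?p)" using f by simp
  have finI: "finite ?\<I>" by (rule finite_subset[of _ "Pow {1..M}"]) auto
  have "expect ?p (\<lambda>g. of_bool (j \<le> card {u\<in>{1..M}. mass g M {u} n \<le> z})) \<le>
      expect ?p (\<lambda>g. of_bool (\<exists>I\<in>?\<I>. \<forall>i\<in>I. mass g M {i} n \<le> z))"
  proof (rule expect_mono[OF fin])
    fix g
    show "of_bool (j \<le> card {u\<in>{1..M}. mass g M {u} n \<le> z}) \<le>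
        (of_bool (\<exists>I\<in>?\<I>. \<forall>i\<in>I. mass g M {i} n \<le> z) :: real)"
    proof (cases "j \<le> card {u\<in>{1..M}. mass g M {u} n \<le> z}")
      case True
      then obtain I where "I \<subseteq> {u\<in>{1..M}. mass g M {u} n \<le> z}" "card I = j"
        by (rule obtain_subset_with_card_n)
      then have "\<exists>I\<in>?\<I>. \<forall>i\<in>I. mass g M {i} n \<le> z" by blast
      then show ?thesis by simp
    qed simp
  qed
  also have "\<dots> \<le> (\<Sum>I\<in>?\<I>. expect ?p (\<lambda>g. of_bool (\<forall>i\<in>I. mass g M {i} n \<le> z)))"
    by (rule expect_ex_le[OF fin finI])
  also have "\<dots> \<le> (\<Sum>I\<in>?\<I>. (1 - tail M n z) ^ j)"
    using expect_all_blocks_small_le[OF f] by (intro sum_mono) blast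
  also have "\<dots> = real (card ?\<I>) * (1 - tail M n z) ^ j" by simp
  also have "\<dots> \<le> 2 ^ M * (1 - tail M n z) ^ j"
  proof (rule mult_right_mono)
    have "card ?\<I> \<le> card (Pow {1..M})" by (intro card_mono) auto
    then have "real (card ?\<I>) \<le> real (2 ^ M)" by (simp add: card_Pow)
    then show "real (card ?\<I>) \<le> 2 ^ M" by simp
    show "0 \<le> (1 - tail M n z) ^ j" using tail_le_1[of M n z] f by simp
  qed
  finally show ?thesis .
qed

text \<open>For two indicators, negative dependence of the events that the masses are small is equivalent to that
  of the complementary events.\<close>

lemma expect_two_masses_large_le:
  assumes f: "valid_parents m f" "1 \<le> m" "m \<le> n" and W: "W \<subseteq> {1..m}" "W' \<subseteq> {1..m}" "W \<inter> W' = {}"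
  shows "expect (grow m (n - m) f) (\<lambda>g. of_bool (z < mass g m W n \<and> z < mass g m W' n))
    \<le> urn m (n - m) (\<lambda>a. of_bool (z < a)) (card W) * urn m (n - m) (\<lambda>a. of_bool (z < a)) (card W')"
proof -
  let ?p = "grow m (n - m) f"
  let ?u = "urn m (n - m) (\<lambda>a. of_bool (z < a))"
  let ?W = "\<lambda>b. if b then W else W'"
  have fin: "finite (set_pmf ?p)" using f by simp
  have "expect ?p (\<lambda>g. \<Prod>b\<in>UNIV. of_bool (mass g m (?W b) (m + (n - m)) \<le> z)) \<le>
      (\<Prod>b\<in>UNIV. urn m (n - m) (\<lambda>a. of_bool (a \<le> z)) (card (?W b)))"
    using f W
    by (intro expect_prod_mass_le[where W = ?W and h = "\<lambda>_ a. of_bool (a \<le> z)"])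
       (auto simp: antimono_le_threshold)
  then have both_small: "expect ?p (\<lambda>g. of_bool (mass g m W n \<le> z) * of_bool (mass g m W' n \<le> z))
      \<le> (1 - ?u (card W)) * (1 - ?u (card W'))"
    using f(3) by (simp add: UNIV_bool urn_le_threshold mult.commute)
  have "expect ?p (\<lambda>g. of_bool (z < mass g m W n \<and> z < mass g m W' n)) =
     expect ?p (\<lambda>g. of_bool (mass g m W n \<le> z) * of_bool (mass g m W' n \<le> z)
       + of_bool (z < mass g m W n) + of_bool (z < mass g m W' n) - 1)"
    by (intro expect_cong) (auto simp: not_less)
  also have "\<dots> = expect ?p (\<lambda>g. of_bool (mass g m W n \<le> z) * of_bool (mass g m W' n \<le> z))
     + ?u (card W) + ?u (card W') - 1"
    using fin expect_threshold[OF f W(1), of z] expect_threshold[OF f W(2), of z]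
    by (simp add: expect_add expect_diff)
  also have "\<dots> \<le> ?u (card W) * ?u (card W')" using both_small by (simp add: algebra_simps)
  finally show ?thesis .
qed


section \<open>Joint estimates for descendant counts\<close>

lemma desc_count_eq_mass_desc: "u \<le> w \<Longrightarrow> w \<le> n \<Longrightarrow> valid_parents n g \<Longrightarrow> 1 \<le> u \<Longrightarrow>
    desc_count g n u = mass g w (desc g w u) n"
  unfolding desc_count_eq_mass using mass_refine[of n g w u "{u}"] by (simp add: desc_def)

lemma desc_cong: "(\<And>i. i \<le> w \<Longrightarrow> g i = f i) \<Longrightarrow> desc g w u = desc f w u"
  unfolding desc_def using block_cong[of _ g f u] by auto

text \<open>Given the tree at time \<open>w\<close>, the subtree of an older vertex \<open>u\<close> is an urn colour started with the current
  descendants of \<open>u\<close>.\<close>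

lemma expect_desc_from:
  assumes "valid_parents w f" "1 \<le> u" "u \<le> w" "w \<le> n"
  shows "expect (grow w (n - w) f) (\<lambda>g. of_bool (z < desc_count g n u)) =
    urn w (n - w) (\<lambda>a. of_bool (z < a)) (desc_count f w u)"
proof -
  have "expect (grow w (n - w) f) (\<lambda>g. of_bool (z < desc_count g n u)) =
      expect (grow w (n - w) f) (\<lambda>g. of_bool (z < mass g w (desc f w u) n))"
  proof (rule expect_cong)
    fix g assume "g \<in> set_pmf (grow w (n - w) f)"
    then have "valid_parents n g" "\<And>i. i \<le> w \<Longrightarrow> g i = f i"
      using grow_valid[OF assms(1) _ assms(4)] assms(2,3) by auto
    then show "of_bool (z < desc_count g n u) = (of_bool (z < mass g w (desc f w u) n) :: real)"
      using desc_count_eq_mass_desc[OF assms(3,4), of g] desc_cong[of w g f u] assms(2) by simp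
  qed
  also have "\<dots> = urn w (n - w) (\<lambda>a. of_bool (z < a)) (desc_count f w u)"
    using assms by (intro expect_threshold) (auto simp: desc_def)
  finally show ?thesis .
qed

lemma desc_count_self:
  assumes "1 \<le> v"
  shows "desc_count f v v = 1"
proof -
  have "desc f v v = {v}" using assms by (auto simp: desc_def)
  then show ?thesis by simp
qed

lemma desc_count_upd:
  assumes "valid_parents n g" "a \<in> {1..n}" "u \<le> n"
  shows "desc_count (g(Suc n := a)) (Suc n) u = desc_count g n u + of_bool (a \<in> desc g n u)"
  unfolding desc_count_eq_mass using mass_step[OF assms, of "{u}"] assms(2) by (simp add: desc_def)

lemma expect_desc_tail:
  assumes "valid_parents v f" "2 \<le> v" "v \<le> n"
  shows "expect (grow v (n - v) f) (\<lambda>g. of_bool (z < desc_count g n v)) = tail v n z"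
  using expect_desc_from[of v f v n z] urn_tail[of v "n - v" z] assms by (simp add: desc_count_self)

lemma expect_desc_tail_later:
  assumes "valid_parents u f" "1 \<le> u" "u \<le> w" "2 \<le> w" "w \<le> n"
  shows "expect (grow u (n - u) f) (\<lambda>g. of_bool (z < desc_count g n w)) = tail w n z"
proof -
  have "expect (grow u (n - u) f) (\<lambda>g. of_bool (z < desc_count g n w)) =
      expect (grow u (w - u) f) (\<lambda>_. tail w n z)"
    unfolding expect_grow_split[OF assms(2,3,5)]
    using expect_desc_tail[OF grow_valid(1)[OF assms(1-3)] assms(4,5)] by (intro expect_cong) auto
  then show ?thesis by simp
qed

lemma expect_random_parents_desc_tail:
  assumes "2 \<le> v" "v \<le> n"
  shows "expect (random_parents n) (\<lambda>g. of_bool (z < desc_count g n v)) = tail v n z"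
  unfolding random_parents_def using assms
  by (intro expect_desc_tail_later) (auto simp: valid_parents_def)

lemma expect_two_desc_from_le:
  assumes f: "valid_parents w f" and uw: "1 \<le> u" "u < w" "w \<le> n" and no: "w \<notin> desc f w u"
  shows "expect (grow w (n - w) f) (\<lambda>g. of_bool (z < desc_count g n u \<and> z < desc_count g n w))
    \<le> urn w (n - w) (\<lambda>a. of_bool (z < a)) (desc_count f w u) * tail w n z"
proof -
  have "expect (grow w (n - w) f) (\<lambda>g. of_bool (z < desc_count g n u \<and> z < desc_count g n w)) =
      expect (grow w (n - w) f) (\<lambda>g. of_bool (z < mass g w (desc f w u) n \<and> z < mass g w {w} n))"
  proof (rule expect_cong)
    fix g assume "g \<in> set_pmf (grow w (n - w) f)"
    then have "valid_parents n g" "\<And>i. i \<le> w \<Longrightarrow> g i = f i"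
      using grow_valid[OF f _ uw(3)] uw by auto
    then show "of_bool (z < desc_count g n u \<and> z < desc_count g n w) =
        (of_bool (z < mass g w (desc f w u) n \<and> z < mass g w {w} n) :: real)"
      using desc_count_eq_mass_desc[of u w n g] desc_cong[of w g f u] uw by (simp add: desc_count_eq_mass[of g n w])
  qed
  also have "\<dots> \<le> urn w (n - w) (\<lambda>a. of_bool (z < a)) (desc_count f w u) *
      urn w (n - w) (\<lambda>a. of_bool (z < a)) (card {w})"
    using f uw no by (intro expect_two_masses_large_le) (auto simp: desc_def)
  finally show ?thesis using urn_tail[of w "n - w" z] uw by simp
qed

text \<open>At time \<open>w\<close>, the current subtree of \<open>u\<close> and the vertex \<open>w\<close> are disjoint if \<open>w\<close> is not a descendant of \<open>u\<close>.
  As \<open>w\<close> always starts with a single ball, the bound for \<open>w\<close> is a constant, and averaging the bound for \<open>u\<close>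
  over the tree at time \<open>w\<close> gives back the law of \<open>D u\<close>.\<close>

lemma expect_incomparable_le:
  assumes f: "valid_parents u f" and uw: "2 \<le> u" "u < w" "w \<le> n"
  shows "expect (grow u (n - u) f)
      (\<lambda>g. of_bool (w \<notin> desc g n u \<and> z < desc_count g n u \<and> z < desc_count g n w))
    \<le> tail u n z * tail w n z"
proof -
  have split: "1 \<le> u" "u \<le> w" "w \<le> n" using uw by auto
  have "expect (grow u (n - u) f)
      (\<lambda>g. of_bool (w \<notin> desc g n u \<and> z < desc_count g n u \<and> z < desc_count g n w)) \<le>
      expect (grow u (w - u) f) (\<lambda>f'.
        expect (grow w (n - w) f') (\<lambda>g. of_bool (z < desc_count g n u)) * tail w n z)"
    unfolding expect_grow_split[OF split]
  proof (rule expect_mono)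
    fix f' assume "f' \<in> set_pmf (grow u (w - u) f)"
    then have f': "valid_parents w f'" using grow_valid(1)[OF f, of w] split by simp
    have same: "w \<in> desc g n u \<longleftrightarrow> w \<in> desc f' w u" if "g \<in> set_pmf (grow w (n - w) f')" for g
      using grow_valid(2)[OF f' _ uw(3) that] uw block_cong[of w g f' u] by (auto simp: desc_def)
    let ?e = "expect (grow w (n - w) f')
      (\<lambda>g. of_bool (w \<notin> desc g n u \<and> z < desc_count g n u \<and> z < desc_count g n w))"
    let ?q = "expect (grow w (n - w) f') (\<lambda>g. of_bool (z < desc_count g n u))"
    have q: "?q = urn w (n - w) (\<lambda>a. of_bool (z < a)) (desc_count f' w u)"
      using uw f' by (intro expect_desc_from) auto
    show "?e \<le> ?q * tail w n z"
    proof (cases "w \<in> desc f' w u")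
      case True
      then have "?e = expect (grow w (n - w) f') (\<lambda>_. 0)" using same by (intro expect_cong) auto
      then show ?thesis unfolding q by (simp add: urn_threshold_nonneg tail_nonneg)
    next
      case False
      then have "?e = expect (grow w (n - w) f') (\<lambda>g. of_bool (z < desc_count g n u \<and> z < desc_count g n w))"
        using same by (intro expect_cong) auto
      also have "\<dots> \<le> ?q * tail w n z" unfolding q using uw f' False
        by (intro expect_two_desc_from_le) auto
      finally show ?thesis .
    qed
  qed (use uw in simp)
  also have "\<dots> = expect (grow u (w - u) f) (\<lambda>f'.
        expect (grow w (n - w) f') (\<lambda>g. of_bool (z < desc_count g n u))) * tail w n z"
    by (rule integral_mult_left_zero)
  also have "\<dots> = tail u n z * tail w n z"
    unfolding expect_grow_split[OF split, symmetric] using expect_desc_tail[OF f, of n z] uw by simp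
  finally show ?thesis .
qed

text \<open>The fraction of balls of one colour is a martingale.\<close>

lemma expect_mean_mass:
  assumes "valid_parents m f" "1 \<le> m" "W \<subseteq> {1..m}"
  shows "expect (grow m k f) (\<lambda>g. real (mass g m W (m + k))) = real (m + k) * real (card W) / real m"
proof (induction k)
  case 0
  then show ?case using mass_initial[OF assms(3)] assms(2) by simp
next
  case (Suc k)
  have "expect (grow m (Suc k) f) (\<lambda>g. real (mass g m W (m + Suc k))) =
      urn m k (urn_step (m + k) real) (card W)"
    using expect_mass[OF assms, of "Suc k" real] by simp
  also have "\<dots> = expect (grow m k f) (\<lambda>g. urn_step (m + k) real (mass g m W (m + k)))"
    using expect_mass[OF assms, of k "urn_step (m + k) real"] by simp
  also have "\<dots> = expect (grow m k f) (\<lambda>g. real (mass g m W (m + k)) * (real (m + Suc k) / real (m + k)))"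
  proof (rule expect_cong)
    fix g
    define a where "a = mass g m W (m + k)"
    have "a \<le> m + k" using mass_le by (simp add: a_def)
    then have "min 1 (real a / real (m + k)) = real a / real (m + k)" using assms(2) by simp
    then show "urn_step (m + k) real (mass g m W (m + k)) =
        real (mass g m W (m + k)) * (real (m + Suc k) / real (m + k))"
      unfolding urn_step_def Let_def a_def[symmetric] using assms(2) by (simp add: field_simps)
  qed
  also have "\<dots> = expect (grow m k f) (\<lambda>g. real (mass g m W (m + k))) * (real (m + Suc k) / real (m + k))"
    by (rule integral_mult_left_zero)
  also have "\<dots> = real (m + Suc k) * real (card W) / real m"
    unfolding Suc using assms(2) by (simp del: of_nat_add)
  finally show ?case .
qed

text \<open>The parent of \<open>w\<close> is a uniformly drawn ball, so this is the expected fraction of the colour started with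
  the single vertex \<open>u\<close>.\<close>

lemma expect_is_desc:
  assumes f: "valid_parents u f" and uw: "1 \<le> u" "u < w"
  shows "expect (grow u (w - u) f) (\<lambda>g. of_bool (w \<in> desc g w u)) = 1 / real u"
proof -
  obtain w' where w': "w = Suc w'" "u \<le> w'" using uw by (cases w) auto
  define k where "k = w' - u"
  have k: "w - u = Suc k" "w' = u + k" using w' by (auto simp: k_def)
  have "expect (grow u (Suc k) f) (\<lambda>g. of_bool (w \<in> desc g w u)) =
      expect (grow u k f) (\<lambda>g. real (mass g u {u} (u + k)) / real (u + k))"
    unfolding expect_grow_Suc[OF uw(1)]
  proof (rule expect_cong)
    fix g assume "g \<in> set_pmf (grow u k f)"
    then have g: "valid_parents (u + k) g" using grow_support[OF f uw(1)] by blast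
    have "w \<in> desc (g(Suc (u + k) := a)) w u \<longleftrightarrow> block g u a \<in> {u}" if "a \<in> {1..u + k}" for a
    proof -
      have "valid_parents w (g(w := a))"
        using g that k w' by (auto simp: valid_parents_def le_Suc_eq)
      then have "block (g(w := a)) u w = block (g(w := a)) u a"
        using block_parent[of w "g(w := a)" w u] k w' uw by simp
      also have "\<dots> = block g u a" using that k w' by (intro block_cong) auto
      finally show ?thesis using k w' uw by (simp add: desc_def)
    qed
    then have "(\<Sum>a\<in>{1..u + k}. of_bool (w \<in> desc (g(Suc (u + k) := a)) w u)) =
        (\<Sum>a\<in>{1..u + k}. of_bool (a \<in> {a. block g u a \<in> {u}}) :: real)"
      by (intro sum.cong) auto
    also have "\<dots> = real (card ({1..u + k} \<inter> {a. block g u a \<in> {u}}))"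
      by (subst sum_of_bool_eq) auto
    finally show "(\<Sum>a\<in>{1..u + k}. of_bool (w \<in> desc (g(Suc (u + k) := a)) w u)) / real (u + k) =
        real (mass g u {u} (u + k)) / real (u + k)" by (simp add: mass_inter)
  qed
  also have "\<dots> = expect (grow u k f) (\<lambda>g. real (mass g u {u} (u + k))) / real (u + k)"
    by (rule integral_divide_zero)
  also have "\<dots> = 1 / real u"
    using expect_mean_mass[OF f uw(1), of "{u}" k] uw by simp
  finally show ?thesis by (simp add: k)
qed

text \<open>Whether \<open>w\<close> descends from \<open>u\<close> is decided at time \<open>w\<close>, whereas the size of the subtree of \<open>w\<close> depends on
  later attachments only.\<close>

lemma expect_desc_and_large:
  assumes f: "valid_parents u f" and uw: "1 \<le> u" "u < w" "w \<le> n"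
  shows "expect (grow u (n - u) f) (\<lambda>g. of_bool (w \<in> desc g n u \<and> z < desc_count g n w))
    = tail w n z / real u"
proof -
  have split: "1 \<le> u" "u \<le> w" "w \<le> n" using uw by auto
  have "expect (grow u (n - u) f) (\<lambda>g. of_bool (w \<in> desc g n u \<and> z < desc_count g n w)) =
      expect (grow u (w - u) f) (\<lambda>f'. of_bool (w \<in> desc f' w u) * tail w n z)"
    unfolding expect_grow_split[OF split]
  proof (rule expect_cong)
    fix f' assume "f' \<in> set_pmf (grow u (w - u) f)"
    then have f': "valid_parents w f'" using grow_valid(1)[OF f, of w] split by simp
    have same: "w \<in> desc g n u \<longleftrightarrow> w \<in> desc f' w u" if "g \<in> set_pmf (grow w (n - w) f')" for g
      using grow_valid(2)[OF f' _ uw(3) that] uw block_cong[of w g f' u] by (auto simp: desc_def)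
    have "expect (grow w (n - w) f') (\<lambda>g. of_bool (w \<in> desc g n u \<and> z < desc_count g n w)) =
        expect (grow w (n - w) f') (\<lambda>g. of_bool (w \<in> desc f' w u) * of_bool (z < desc_count g n w))"
      using same by (intro expect_cong) auto
    also have "\<dots> = of_bool (w \<in> desc f' w u) * expect (grow w (n - w) f') (\<lambda>g. of_bool (z < desc_count g n w))"
      by (rule integral_mult_right_zero)
    finally show "expect (grow w (n - w) f') (\<lambda>g. of_bool (w \<in> desc g n u \<and> z < desc_count g n w)) =
        of_bool (w \<in> desc f' w u) * tail w n z"
      using expect_desc_tail[OF f', of n z] uw by simp
  qed
  also have "\<dots> = expect (grow u (w - u) f) (\<lambda>f'. of_bool (w \<in> desc f' w u)) * tail w n z"
    by (rule integral_mult_left_zero)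
  finally show ?thesis using expect_is_desc[OF f uw(1,2)] by simp
qed

lemma expect_both_large_le:
  assumes f: "valid_parents u f" and uw: "2 \<le> u" "u < w" "w \<le> n"
  shows "expect (grow u (n - u) f) (\<lambda>g. of_bool (z < desc_count g n u \<and> z < desc_count g n w))
    \<le> tail u n z * tail w n z + tail w n z / real u"
proof -
  have "expect (grow u (n - u) f) (\<lambda>g. of_bool (z < desc_count g n u \<and> z < desc_count g n w)) \<le>
      expect (grow u (n - u) f) (\<lambda>g.
        of_bool (w \<notin> desc g n u \<and> z < desc_count g n u \<and> z < desc_count g n w)
        + of_bool (w \<in> desc g n u \<and> z < desc_count g n w))"
    using uw by (intro expect_mono) auto
  also have "\<dots> \<le> tail u n z * tail w n z + tail w n z / real u"
    using expect_incomparable_le[OF f uw, of z] expect_desc_and_large[OF f, of w n z] uw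
    by (simp add: expect_add)
  finally show ?thesis .
qed

lemma expect_random_parents_both_large_le:
  assumes "2 \<le> u" "u < w" "w \<le> n"
  shows "expect (random_parents n) (\<lambda>g. of_bool (z < desc_count g n u \<and> z < desc_count g n w))
    \<le> tail u n z * tail w n z + tail w n z / real u"
proof -
  have "1 \<le> u" "u \<le> n" using assms by auto
  then have "expect (random_parents n) (\<lambda>g. of_bool (z < desc_count g n u \<and> z < desc_count g n w)) \<le>
     expect (random_parents u) (\<lambda>_. tail u n z * tail w n z + tail w n z / real u)"
    unfolding expect_random_parents_split[OF \<open>1 \<le> u\<close> \<open>u \<le> n\<close>]
    using expect_both_large_le[OF random_parents_valid assms] by (intro expect_mono) auto
  then show ?thesis by simp
qed


section \<open>Conditioning on the parent of a vertex\<close>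

lemma expect_random_parents_Suc:
  assumes "1 \<le> v"
  shows "expect (random_parents (Suc v)) h = expect (random_parents v) (\<lambda>g. (\<Sum>a\<in>{1..v}. h (g(Suc v := a))) / real v)"
  using expect_grow_Suc[of 1 "v - 1" "\<lambda>_. 0" h] assms by (simp add: random_parents_def)

lemma expect_parent_le:
  assumes "2 \<le> v" "k \<le> v - 1"
  shows "expect (random_parents v) (\<lambda>f. of_bool (f v \<le> k)) = real k / real (v - 1)"
proof -
  obtain v' where v': "v = Suc v'" "1 \<le> v'" using assms by (cases v) auto
  have "{1..v'} \<inter> {a. a \<le> k} = {1..k}" using assms v' by auto
  then show ?thesis using v' by (simp add: expect_random_parents_Suc sum_of_bool_eq)
qed

text \<open>The parent of \<open>v\<close> is part of the tree at time \<open>v\<close>, and the bound \<open>b\<close> holds whatever this tree is; hence the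
  condition on the parent contributes its full probability \<open>k / (v - 1)\<close> as a factor.\<close>

lemma expect_parent_indep_le:
  assumes v: "2 \<le> v" "v \<le> n" "k \<le> v - 1"
    and b: "\<And>f. valid_parents v f \<Longrightarrow> expect (grow v (n - v) f) h \<le> b"
  shows "expect (random_parents n) (\<lambda>g. of_bool (g v \<le> k) * h g) \<le> real k / real (v - 1) * b"
proof -
  have v1: "1 \<le> v" using v by simp
  have "expect (random_parents n) (\<lambda>g. of_bool (g v \<le> k) * h g) \<le> expect (random_parents v) (\<lambda>f. of_bool (f v \<le> k) * b)"
    unfolding expect_random_parents_split[OF v1 v(2)]
  proof (rule expect_mono)
    fix f assume "f \<in> set_pmf (random_parents v)"
    then have f: "valid_parents v f" using random_parents_valid v by simp
    have "expect (grow v (n - v) f) (\<lambda>g. of_bool (g v \<le> k) * h g) =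
        expect (grow v (n - v) f) (\<lambda>g. of_bool (f v \<le> k) * h g)"
      using grow_valid(2)[OF f _ v(2)] v by (intro expect_cong) auto
    also have "\<dots> = of_bool (f v \<le> k) * expect (grow v (n - v) f) h"
      by (rule integral_mult_right_zero)
    also have "\<dots> \<le> of_bool (f v \<le> k) * b" using b[OF f] by (intro mult_left_mono) auto
    finally show "expect (grow v (n - v) f) (\<lambda>g. of_bool (g v \<le> k) * h g) \<le> of_bool (f v \<le> k) * b" .
  qed simp
  also have "\<dots> = expect (random_parents v) (\<lambda>f. of_bool (f v \<le> k)) * b" by (rule integral_mult_left_zero)
  finally show ?thesis using expect_parent_le[OF v(1,3)] by simp
qed

lemma expect_parent_and_large:
  assumes v: "2 \<le> v" "v \<le> n" "k \<le> v - 1"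
  shows "expect (random_parents n) (\<lambda>g. of_bool (g v \<le> k \<and> z < desc_count g n v)) = real k / real (v - 1) * tail v n z"
proof (rule antisym)
  have eq: "expect (grow v (n - v) f) (\<lambda>g. of_bool (z < desc_count g n v)) = tail v n z"
    if "valid_parents v f" for f using expect_desc_tail[OF that v(1,2)] .
  show "expect (random_parents n) (\<lambda>g. of_bool (g v \<le> k \<and> z < desc_count g n v)) \<le> real k / real (v - 1) * tail v n z"
    using expect_parent_indep_le[OF v, of "\<lambda>g. of_bool (z < desc_count g n v)" "tail v n z"] eq
    by (simp add: of_bool_conj)
  have "expect (grow v (n - v) f) (\<lambda>g. - of_bool (z < desc_count g n v)) \<le> - tail v n z"
    if "valid_parents v f" for f using eq[OF that] by simp
  then have "expect (random_parents n) (\<lambda>g. of_bool (g v \<le> k) * (- of_bool (z < desc_count g n v)))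
      \<le> real k / real (v - 1) * - tail v n z"
    using expect_parent_indep_le[OF v] by blast
  then show "real k / real (v - 1) * tail v n z \<le>
      expect (random_parents n) (\<lambda>g. of_bool (g v \<le> k \<and> z < desc_count g n v))"
    by (simp add: of_bool_conj)
qed

text \<open>Here \<open>u\<close> is older than \<open>v\<close>, but too young for \<open>v\<close> to descend from it when the parent of \<open>v\<close> is at most \<open>k\<close>.
  Given the tree at time \<open>v - 1\<close>, each of the \<open>k\<close> admissible parents leaves the subtree of \<open>u\<close> as it is. The
  resulting urn, in which \<open>u\<close> is not served at time \<open>v\<close>, is dominated by the original one.\<close>

lemma expect_parent_older_le:
  assumes uv: "1 \<le> k" "k < u" "u < v" "v \<le> n"
  shows "expect (random_parents n) (\<lambda>g. of_bool (g v \<le> k \<and> z < desc_count g n u \<and> z < desc_count g n v))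
    \<le> real k / real (v - 1) * (tail u n z * tail v n z)"
proof -
  obtain v' where v': "v = Suc v'" "u \<le> v'" using uv by (cases v) auto
  have v1: "1 \<le> v'" using v' uv by simp
  define U where "U = urn v (n - v) (\<lambda>a. of_bool (z < a))"
  have "expect (random_parents n) (\<lambda>g. of_bool (g v \<le> k \<and> z < desc_count g n u \<and> z < desc_count g n v))
    = expect (random_parents v) (\<lambda>f. expect (grow v (n - v) f)
        (\<lambda>g. of_bool (g v \<le> k \<and> z < desc_count g n u \<and> z < desc_count g n v)))"
    using uv by (intro expect_random_parents_split) auto
  also have "\<dots> \<le> expect (random_parents v) (\<lambda>f. of_bool (f v \<le> k) * U (desc_count f v u) * tail v n z)"
  proof (rule expect_mono)
    fix f assume "f \<in> set_pmf (random_parents v)"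
    then have f: "valid_parents v f" using random_parents_valid uv by simp
    have "expect (grow v (n - v) f)
        (\<lambda>g. of_bool (g v \<le> k \<and> z < desc_count g n u \<and> z < desc_count g n v)) =
      expect (grow v (n - v) f)
        (\<lambda>g. of_bool (f v \<le> k) * of_bool (z < desc_count g n u \<and> z < desc_count g n v))"
      using grow_valid(2)[OF f _ uv(4)] uv by (intro expect_cong) auto
    also have "\<dots> = of_bool (f v \<le> k) * expect (grow v (n - v) f)
        (\<lambda>g. of_bool (z < desc_count g n u \<and> z < desc_count g n v))"
      by (rule integral_mult_right_zero)
    also have "\<dots> \<le> of_bool (f v \<le> k) * (U (desc_count f v u) * tail v n z)"
    proof (cases "f v \<le> k")
      case True
      have "block f u v = f v" using block_parent[OF f, of v u] True uv by simp
      then have "v \<notin> desc f v u" using True uv by (simp add: desc_def)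
      then show ?thesis using expect_two_desc_from_le[OF f, of u n z] uv by (simp add: U_def)
    qed simp
    finally show "expect (grow v (n - v) f)
        (\<lambda>g. of_bool (g v \<le> k \<and> z < desc_count g n u \<and> z < desc_count g n v))
      \<le> of_bool (f v \<le> k) * U (desc_count f v u) * tail v n z" by (simp add: mult.assoc)
  qed simp
  also have "\<dots> = expect (random_parents v) (\<lambda>f. of_bool (f v \<le> k) * U (desc_count f v u)) * tail v n z"
    by (rule integral_mult_left_zero)
  also have "expect (random_parents v) (\<lambda>f. of_bool (f v \<le> k) * U (desc_count f v u)) =
      expect (random_parents v') (\<lambda>g. real k / real v' * U (desc_count g v' u))"
    unfolding v'(1) expect_random_parents_Suc[OF v1]
  proof (rule expect_cong)
    fix g assume "g \<in> set_pmf (random_parents v')"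
    then have g: "valid_parents v' g" using random_parents_valid v' uv by simp
    have "(\<Sum>a\<in>{1..v'}. of_bool ((g(Suc v' := a)) (Suc v') \<le> k) * U (desc_count (g(Suc v' := a)) (Suc v') u)) =
       (\<Sum>a\<in>{1..v'}. of_bool (a \<in> {..k}) * U (desc_count g v' u))"
    proof (rule sum.cong)
      fix a assume a: "a \<in> {1..v'}"
      have "a \<notin> desc g v' u" if "a \<le> k" using that uv by (auto simp: desc_def)
      then show "of_bool ((g(Suc v' := a)) (Suc v') \<le> k) * U (desc_count (g(Suc v' := a)) (Suc v') u) =
          of_bool (a \<in> {..k}) * U (desc_count g v' u)"
        using desc_count_upd[OF g a v'(2)] by auto
    qed simp
    also have "\<dots> = real (card ({1..v'} \<inter> {..k})) * U (desc_count g v' u)"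
      by (simp add: sum_distrib_right[symmetric] sum_of_bool_eq Int_def)
    also have "{1..v'} \<inter> {..k} = {1..k}" using v' uv by auto
    also have "real (card {1..k}) = real k" by simp
    finally show "(\<Sum>a\<in>{1..v'}. of_bool ((g(Suc v' := a)) (Suc v') \<le> k) *
        U (desc_count (g(Suc v' := a)) (Suc v') u)) / real v' = real k / real v' * U (desc_count g v' u)"
      by (simp only: times_divide_eq_left)
  qed
  also have "\<dots> = real k / real v' * expect (random_parents v') (\<lambda>g. U (desc_count g v' u))"
    by (rule integral_mult_right_zero)
  finally have main: "expect (random_parents n) (\<lambda>g. of_bool (g v \<le> k \<and> z < desc_count g n u \<and> z < desc_count g n v))
      \<le> real k / real v' * expect (random_parents v') (\<lambda>g. U (desc_count g v' u)) * tail v n z" .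
  \<comment> \<open>Serving \<open>u\<close> at time \<open>v\<close> as well can only increase its final size.\<close>
  have "expect (random_parents v') (\<lambda>g. U (desc_count g v' u)) \<le> expect (random_parents v) (\<lambda>f. U (desc_count f v u))"
    unfolding v'(1) expect_random_parents_Suc[OF v1]
  proof (rule expect_mono)
    fix g assume "g \<in> set_pmf (random_parents v')"
    then have g: "valid_parents v' g" using random_parents_valid v' uv by simp
    have "(\<Sum>a\<in>{1..v'}. U (desc_count g v' u)) \<le> (\<Sum>a\<in>{1..v'}. U (desc_count (g(Suc v' := a)) (Suc v') u))"
      unfolding U_def using desc_count_upd[OF g _ v'(2)] by (intro sum_mono urn_threshold_mono) auto
    then show "U (desc_count g v' u) \<le> (\<Sum>a\<in>{1..v'}. U (desc_count (g(Suc v' := a)) (Suc v') u)) / real v'"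
      using v' uv by (simp add: field_simps)
  qed simp
  also have "expect (random_parents v) (\<lambda>f. U (desc_count f v u)) = tail u n z"
  proof -
    have "expect (random_parents v) (\<lambda>f. U (desc_count f v u)) =
        expect (random_parents v) (\<lambda>f. expect (grow v (n - v) f) (\<lambda>g. of_bool (z < desc_count g n u)))"
      unfolding U_def using uv random_parents_valid by (intro expect_cong expect_desc_from[symmetric]) auto
    then show ?thesis using expect_random_parents_split[of v n] expect_random_parents_desc_tail[of u n z] uv by simp
  qed
  finally have "real k / real v' * expect (random_parents v') (\<lambda>g. U (desc_count g v' u)) * tail v n z
      \<le> real k / real v' * tail u n z * tail v n z"
    by (intro mult_right_mono mult_left_mono tail_nonneg) auto
  then show ?thesis using main v' by (simp add: mult.assoc)
qed


section \<open>Transfer to the Jordan ordering\<close>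

lemma set_pmf_jordan_ordering:
  "set_pmf (jordan_ordering (tree_of n f)) = rankings {1..n} (jordan_centrality (tree_of n f))"
  unfolding jordan_ordering_def
  using rankings_nonempty finite_rankings by (subst set_pmf_of_set) (auto simp: tree_of_def)

lemma prob_ordering:
  assumes "1 \<le> n"
  shows "measure_pmf.prob (rrt_jordan_ordering n) {\<sigma>. Q \<sigma>} =
    expect (random_parents n) (\<lambda>f. expect (jordan_ordering (tree_of n f)) (\<lambda>\<sigma>. of_bool (Q \<sigma>)))"
  unfolding prob_eq_expect rrt_jordan_ordering_def recursive_tree_eq_random_parents[OF assms] bind_map_pmf
  by (subst expect_bind) (auto simp: set_pmf_jordan_ordering finite_rankings)

lemma prob_ordering_le:
  assumes "1 \<le> n"
    and "\<And>f \<sigma>. valid_parents n f \<Longrightarrow> \<sigma> \<in> rankings {1..n} (jordan_centrality (tree_of n f)) \<Longrightarrow> Q \<sigma> \<Longrightarrow> P f"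
  shows "measure_pmf.prob (rrt_jordan_ordering n) {\<sigma>. Q \<sigma>} \<le> expect (random_parents n) (\<lambda>f. of_bool (P f))"
  unfolding prob_ordering[OF assms(1)]
proof (rule expect_mono)
  fix f assume "f \<in> set_pmf (random_parents n)"
  then have f: "valid_parents n f" using random_parents_valid assms by simp
  have "expect (jordan_ordering (tree_of n f)) (\<lambda>\<sigma>. of_bool (Q \<sigma>)) \<le>
      expect (jordan_ordering (tree_of n f)) (\<lambda>_. of_bool (P f))"
    using assms(2)[OF f] by (intro expect_mono) (auto simp: set_pmf_jordan_ordering finite_rankings)
  then show "expect (jordan_ordering (tree_of n f)) (\<lambda>\<sigma>. of_bool (Q \<sigma>)) \<le> of_bool (P f)" by simp
qed simp

lemma prob_ordering_ge:
  assumes "1 \<le> n"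
    and "\<And>f \<sigma>. valid_parents n f \<Longrightarrow> P f \<Longrightarrow> \<sigma> \<in> rankings {1..n} (jordan_centrality (tree_of n f)) \<Longrightarrow> Q \<sigma>"
  shows "expect (random_parents n) (\<lambda>f. of_bool (P f)) \<le> measure_pmf.prob (rrt_jordan_ordering n) {\<sigma>. Q \<sigma>}"
  unfolding prob_ordering[OF assms(1)]
proof (rule expect_mono)
  fix f assume "f \<in> set_pmf (random_parents n)"
  then have f: "valid_parents n f" using random_parents_valid assms by simp
  have "expect (jordan_ordering (tree_of n f)) (\<lambda>_. of_bool (P f)) \<le>
      expect (jordan_ordering (tree_of n f)) (\<lambda>\<sigma>. of_bool (Q \<sigma>))"
    using assms(2)[OF f] by (intro expect_mono) (auto simp: set_pmf_jordan_ordering finite_rankings)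
  then show "of_bool (P f) \<le> expect (jordan_ordering (tree_of n f)) (\<lambda>\<sigma>. of_bool (Q \<sigma>))" by simp
qed simp


section \<open>The number of vertices with many descendants\<close>

lemma card_eq_sum_of_bool:
  "finite I \<Longrightarrow> real (card {i\<in>I. P i}) = (\<Sum>i\<in>I. of_bool (P i))"
  by (simp add: sum_of_bool_eq Int_def)

lemma sum_geometric_le:
  fixes r :: real
  assumes "0 \<le> r" "r < 1"
  shows "(\<Sum>i<m. r ^ i) \<le> 1 / (1 - r)"
proof -
  have "(1 - r) * (\<Sum>i<m. r ^ i) = 1 - r ^ m" by (simp add: one_diff_power_eq)
  also have "\<dots> \<le> 1" using assms by simp
  finally show ?thesis using assms by (simp add: field_simps)
qed

lemma sum_arith_geometric_le:
  fixes r :: real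
  assumes "0 \<le> r" "r < 1"
  shows "(\<Sum>i<m. real i * r ^ i) \<le> 1 / (1 - r)\<^sup>2"
proof -
  have "(1 - r) * (\<Sum>i<m. (real i + 1) * r ^ i) = (\<Sum>i<m. r ^ i) - real m * r ^ m"
  proof (induction m)
    case (Suc m)
    have split: "(1 - r) * (\<Sum>i<Suc m. (real i + 1) * r ^ i) =
        (1 - r) * (\<Sum>i<m. (real i + 1) * r ^ i) + (1 - r) * ((real m + 1) * r ^ m)"
      by (simp add: distrib_left)
    have last: "(1 - r) * ((real m + 1) * r ^ m) = r ^ m + real m * r ^ m - real (Suc m) * r ^ Suc m"
      by (simp add: algebra_simps)
    show ?case unfolding split Suc last by simp
  qed simp
  also have "\<dots> \<le> 1 / (1 - r)"
    using sum_geometric_le[OF assms, of m] assms by (smt (verit) mult_nonneg_nonneg of_nat_0_le_iff zero_le_power)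
  finally have "(1 - r) * (\<Sum>i<m. (real i + 1) * r ^ i) \<le> 1 / (1 - r)" .
  then have "(\<Sum>i<m. (real i + 1) * r ^ i) \<le> 1 / (1 - r) / (1 - r)"
    using assms by (metis diff_gt_0_iff_gt mult.commute pos_le_divide_eq)
  then have "(\<Sum>i<m. (real i + 1) * r ^ i) \<le> 1 / (1 - r)\<^sup>2"
    by (simp add: power2_eq_square)
  moreover have "(\<Sum>i<m. real i * r ^ i) \<le> (\<Sum>i<m. (real i + 1) * r ^ i)"
    using assms by (intro sum_mono mult_right_mono) auto
  ultimately show ?thesis by linarith
qed

context
  fixes n z :: nat
  assumes n: "2 \<le> n" and z: "1 \<le> z" "z \<le> n - 1"
begin

lemma tail_rate: "0 \<le> 1 - real z / real (n - 1)" "1 - real z / real (n - 1) < 1"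
  using n z by (auto simp: field_simps)

lemma sum_tail_after_le:
  assumes "1 \<le> v"
  shows "(\<Sum>u\<in>{v..n}. tail u n z) \<le> tail v n z * (real (n - 1) / real z)"
proof -
  let ?r = "1 - real z / real (n - 1)"
  have "(\<Sum>u\<in>{v..n}. tail u n z) \<le> (\<Sum>u\<in>{v..n}. tail v n z * ?r ^ (u - v))"
    using tail_add_le[of v _ n z] assms z by (intro sum_mono) (metis atLeastAtMost_iff le_add_diff_inverse)
  also have "\<dots> = tail v n z * (\<Sum>i<Suc n - v. ?r ^ i)"
    unfolding sum_distrib_left
    by (rule sum.reindex_bij_witness[where i = "\<lambda>i. i + v" and j = "\<lambda>u. u - v"]) auto
  also have "\<dots> \<le> tail v n z * (1 / (1 - ?r))"
    using sum_geometric_le[OF tail_rate] by (intro mult_left_mono tail_nonneg)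
  finally show ?thesis by simp
qed

lemma sum_weighted_tail_le:
  "(\<Sum>u\<in>{1..n}. real (u - 1) * tail u n z) \<le> (real (n - 1) / real z)\<^sup>2"
proof -
  let ?r = "1 - real z / real (n - 1)"
  have "(\<Sum>u\<in>{1..n}. real (u - 1) * tail u n z) \<le> (\<Sum>u\<in>{1..n}. real (u - 1) * ?r ^ (u - 1))"
    using z by (intro sum_mono mult_left_mono tail_le_power) auto
  also have "\<dots> = (\<Sum>i<n. real i * ?r ^ i)"
    by (rule sum.reindex_bij_witness[where i = Suc and j = "\<lambda>u. u - 1"]) auto
  also have "\<dots> \<le> 1 / (1 - ?r)\<^sup>2" by (rule sum_arith_geometric_le[OF tail_rate])
  finally show ?thesis by (simp add: power_divide)
qed

lemma sum_tail_le:
  assumes "1 \<le> k"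
  shows "(\<Sum>u\<in>{k<..n}. tail u n z) \<le> real (n - 1) / real z"
proof -
  have "(\<Sum>u\<in>{k<..n}. tail u n z) \<le> (\<Sum>u\<in>{1..n}. tail u n z)"
    by (intro sum_mono2) (auto simp: tail_nonneg)
  then show ?thesis using sum_tail_after_le[of 1] by simp
qed

text \<open>The terms with \<open>u = w\<close> contribute \<open>\<mu>\<close>. For \<open>u < w\<close>, the product terms add up to at most \<open>\<mu>\<^sup>2\<close>, and the
  ancestry terms \<open>tail w n z / u \<le> tail w n z / k\<close> to a sum that is still of order \<open>n / z\<close> when \<open>k\<close> is.\<close>

lemma expect_square_count_large_le:
  assumes k: "1 \<le> k"
  defines "\<mu> \<equiv> \<Sum>u\<in>{k<..n}. tail u n z"
  shows "expect (random_parents n) (\<lambda>f. (real (card {u\<in>{k<..n}. z < desc_count f n u}))\<^sup>2)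
    \<le> \<mu>\<^sup>2 + \<mu> + 2 / real k * (real (n - 1) / real z)\<^sup>2"
proof -
  let ?I = "{k<..n}" and ?p = "\<lambda>u. tail u n z"
  let ?e = "\<lambda>u w. expect (random_parents n) (\<lambda>f. of_bool (z < desc_count f n u \<and> z < desc_count f n w))"
  have lt: "?e u w \<le> ?p u * ?p w + ?p w / real k" if "u \<in> ?I" "w \<in> ?I" "u < w" for u w
  proof -
    have "?e u w \<le> ?p u * ?p w + ?p w / real u" using that k by (intro expect_random_parents_both_large_le) auto
    also have "?p w / real u \<le> ?p w / real k"
      using that k by (intro divide_left_mono tail_nonneg) auto
    finally show ?thesis by simp
  qed
  have sym: "?e u w = ?e w u" for u w by (simp add: conj_commute)
  have bound: "?e u w \<le> ?p u * ?p w + ((if u = w then ?p w else 0)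
      + ((if u < w then ?p w / real k else 0) + (if w < u then ?p u / real k else 0)))"
    if "u \<in> ?I" "w \<in> ?I" for u w
  proof -
    consider "u < w" | "u = w" | "w < u" by linarith
    then show ?thesis
    proof cases
      case 2
      then have "?e u w = ?p w" using expect_random_parents_desc_tail[of w n z] that k by simp
      then show ?thesis using 2 by (simp add: tail_nonneg)
    next
      case 3
      then show ?thesis using lt[of w u] sym[of u w] that by (simp add: mult.commute)
    qed (use lt[of u w] that in simp)
  qed
  have below: "(\<Sum>u\<in>?I. \<Sum>w\<in>?I. if u < w then ?p w / real k else 0) \<le> (real (n - 1) / real z)\<^sup>2 / real k"
  proof -
    have "(\<Sum>u\<in>?I. \<Sum>w\<in>?I. if u < w then ?p w / real k else 0) =
        (\<Sum>w\<in>?I. \<Sum>u\<in>?I. if u < w then ?p w / real k else 0)" by (rule sum.swap)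
    also have "\<dots> \<le> (\<Sum>w\<in>?I. real (w - 1) * ?p w / real k)"
    proof (rule sum_mono)
      fix w assume w: "w \<in> ?I"
      have "(\<Sum>u\<in>?I. if u < w then ?p w / real k else 0) = real (card (?I \<inter> {..<w})) * (?p w / real k)"
        by (simp add: sum.If_cases Int_def lessThan_def)
      also have "\<dots> \<le> real (w - 1) * (?p w / real k)"
      proof -
        have "?I \<inter> {..<w} \<subseteq> {1..w - 1}" using k by auto
        then have "card (?I \<inter> {..<w}) \<le> w - 1" using card_mono[of "{1..w - 1}"] by fastforce
        then show ?thesis using k by (intro mult_right_mono) (auto simp: tail_nonneg)
      qed
      finally show "(\<Sum>u\<in>?I. if u < w then ?p w / real k else 0) \<le> real (w - 1) * ?p w / real k" by simp
    qed
    also have "\<dots> = (\<Sum>w\<in>?I. real (w - 1) * ?p w) / real k" by (simp add: sum_divide_distrib)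
    also have "\<dots> \<le> (\<Sum>w\<in>{1..n}. real (w - 1) * ?p w) / real k"
      by (intro divide_right_mono sum_mono2) (auto simp: tail_nonneg)
    also have "\<dots> \<le> (real (n - 1) / real z)\<^sup>2 / real k"
      by (intro divide_right_mono sum_weighted_tail_le) auto
    finally show ?thesis .
  qed
  have above: "(\<Sum>u\<in>?I. \<Sum>w\<in>?I. if w < u then ?p u / real k else 0) \<le> (real (n - 1) / real z)\<^sup>2 / real k"
    using below by (subst sum.swap)
  have sq: "(real (card {u\<in>?I. z < desc_count f n u}))\<^sup>2 =
      (\<Sum>u\<in>?I. \<Sum>w\<in>?I. of_bool (z < desc_count f n u \<and> z < desc_count f n w))" for f
    by (simp only: card_eq_sum_of_bool finite_greaterThanAtMost power2_eq_square sum_product of_bool_conj)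
  have "expect (random_parents n) (\<lambda>f. (real (card {u\<in>?I. z < desc_count f n u}))\<^sup>2) = (\<Sum>u\<in>?I. \<Sum>w\<in>?I. ?e u w)"
    unfolding sq by (simp only: expect_sum finite_random_parents)
  also have "\<dots> \<le> (\<Sum>u\<in>?I. \<Sum>w\<in>?I. ?p u * ?p w + ((if u = w then ?p w else 0)
      + ((if u < w then ?p w / real k else 0) + (if w < u then ?p u / real k else 0))))"
    using bound by (intro sum_mono) blast
  also have "\<dots> = \<mu>\<^sup>2 + (\<mu> + ((\<Sum>u\<in>?I. \<Sum>w\<in>?I. if u < w then ?p w / real k else 0)
      + (\<Sum>u\<in>?I. \<Sum>w\<in>?I. if w < u then ?p u / real k else 0)))"
    unfolding sum.distrib by (simp add: \<mu>_def power2_eq_square sum_product)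
  also have "\<dots> \<le> \<mu>\<^sup>2 + \<mu> + 2 / real k * (real (n - 1) / real z)\<^sup>2"
    using below above by simp
  finally show ?thesis .
qed

text \<open>Chebyshev's inequality, with \<open>(n - 1) / z\<close> as an upper bound for the mean.\<close>

lemma prob_count_large_le:
  assumes k: "1 \<le> k" and t: "real (n - 1) / real z < t"
  shows "expect (random_parents n) (\<lambda>f. of_bool (t \<le> real (card {u\<in>{k<..n}. z < desc_count f n u})))
    \<le> (real (n - 1) / real z + 2 / real k * (real (n - 1) / real z)\<^sup>2) / (t - real (n - 1) / real z)\<^sup>2"
proof -
  define \<mu> where "\<mu> = (\<Sum>u\<in>{k<..n}. tail u n z)"
  define N where "N f = real (card {u\<in>{k<..n}. z < desc_count f n u})" for f
  define b where "b = real (n - 1) / real z"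
  have bt: "b < t" using t by (simp add: b_def)
  have mu: "\<mu> \<le> b" using sum_tail_le[OF k] by (simp add: \<mu>_def b_def)
  have EN: "expect (random_parents n) N = \<mu>"
  proof -
    have "expect (random_parents n) N = expect (random_parents n) (\<lambda>f. \<Sum>u\<in>{k<..n}. of_bool (z < desc_count f n u))"
      unfolding N_def by (subst card_eq_sum_of_bool) auto
    also have "\<dots> = (\<Sum>u\<in>{k<..n}. expect (random_parents n) (\<lambda>f. of_bool (z < desc_count f n u)))"
      by (rule expect_sum) simp
    also have "\<dots> = \<mu>" unfolding \<mu>_def using k by (intro sum.cong expect_random_parents_desc_tail) auto
    finally show ?thesis .
  qed
  have "expect (random_parents n) (\<lambda>f. of_bool (t \<le> N f)) * (t - b)\<^sup>2 =
      expect (random_parents n) (\<lambda>f. of_bool (t \<le> N f) * (t - b)\<^sup>2)" by (rule integral_mult_left_zero[symmetric])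
  also have "\<dots> \<le> expect (random_parents n) (\<lambda>f. (N f)\<^sup>2 + (\<mu>\<^sup>2 - 2 * \<mu> * N f))"
  proof (rule expect_mono)
    fix f
    have "of_bool (t \<le> N f) * (t - b)\<^sup>2 \<le> (N f - \<mu>)\<^sup>2"
      using mu bt by (auto intro!: power_mono)
    then show "of_bool (t \<le> N f) * (t - b)\<^sup>2 \<le> (N f)\<^sup>2 + (\<mu>\<^sup>2 - 2 * \<mu> * N f)"
      by (simp add: power2_diff algebra_simps)
  qed simp
  also have "\<dots> = expect (random_parents n) (\<lambda>f. (N f)\<^sup>2) + (\<mu>\<^sup>2 - 2 * \<mu> * expect (random_parents n) N)"
    by (simp add: expect_add expect_diff)
  also have "\<dots> \<le> \<mu> + 2 / real k * b\<^sup>2"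
  proof -
    have "expect (random_parents n) (\<lambda>f. (N f)\<^sup>2) \<le> \<mu>\<^sup>2 + \<mu> + 2 / real k * b\<^sup>2"
      unfolding N_def \<mu>_def b_def by (rule expect_square_count_large_le[OF k])
    then show ?thesis unfolding EN by (simp add: power2_eq_square[of \<mu>])
  qed
  also have "\<dots> \<le> b + 2 / real k * b\<^sup>2" using mu by simp
  finally show ?thesis using t by (simp add: N_def b_def pos_le_divide_eq)
qed

end


section \<open>The four tail bounds\<close>

lemma power_one_minus_le_exp:
  fixes x :: real
  assumes "x \<le> 1"
  shows "(1 - x) ^ k \<le> exp (- (real k * x))"
proof -
  have "(1 - x) ^ k \<le> exp (- x) ^ k"
    using assms exp_ge_add_one_self[of "- x"] by (intro power_mono) auto
  then show ?thesis by (simp add: exp_of_nat_mult[symmetric])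
qed

lemma exp_le_one_minus:
  fixes t :: real
  assumes "0 \<le> t" "t \<le> 1 / 2"
  shows "exp (- 2 * t) \<le> 1 - t"
proof -
  have "2 * t\<^sup>2 \<le> t" using assms mult_left_mono[of t "1 / 2" t] by (simp add: power2_eq_square)
  then have "- 2 * t \<le> - t - 2 * t\<^sup>2" by simp
  also have "\<dots> \<le> ln (1 - t)" using ln_one_minus_pos_lower_bound[of t] assms by simp
  finally have "exp (- 2 * t) \<le> exp (ln (1 - t))" by simp
  then show ?thesis using assms by simp
qed

lemma real_div_bounds:
  assumes "0 < (b::nat)"
  shows "real (a div b) * real b \<le> real a" "real a < (real (a div b) + 1) * real b"
proof -
  have "real ((a div b) * b) \<le> real a" unfolding of_nat_le_iff by simp
  then show "real (a div b) * real b \<le> real a" by simp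
  have "real a < real ((a div b + 1) * b)"
    unfolding of_nat_less_iff using dividend_less_div_times[OF assms, of a] by simp
  then show "real a < (real (a div b) + 1) * real b" by (simp add: algebra_simps)
qed

text \<open>If the centrality of \<open>v\<close> exceeds \<open>z\<close>, then only the vertices up to \<open>k\<close> and those beyond \<open>k\<close> with more than
  \<open>z\<close> descendants can be ranked before \<open>v\<close>. A first moment bound for the latter would lose a logarithm in
  \<open>S\<close>, because it would force \<open>z\<close> to be larger by that factor.\<close>

lemma rank_upper_tail_le:
  fixes S :: real
  assumes v: "v \<in> {1..n}" and S: "1 \<le> S"
  shows "measure_pmf.prob (rrt_jordan_ordering n) {\<sigma>. S * real v \<le> real (\<sigma> v)} \<le> 100 / S"
proof -
  define T where "T = S * real v"
  have n1: "1 \<le> n" using v by simp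
  consider "real n < T" | "S \<le> 100" | "100 < S" "T \<le> real n" by linarith
  then show ?thesis
  proof cases
    case 1
    have "measure_pmf.prob (rrt_jordan_ordering n) {\<sigma>. S * real v \<le> real (\<sigma> v)} \<le>
        expect (random_parents n) (\<lambda>f. of_bool False)"
    proof (rule prob_ordering_le[OF n1])
      fix f \<sigma>
      assume "\<sigma> \<in> rankings {1..n} (jordan_centrality (tree_of n f))" "S * real v \<le> real (\<sigma> v)"
      then show False using rank_range[of \<sigma> "{1..n}" _ v] v 1 by (simp add: T_def)
    qed
    then have "measure_pmf.prob (rrt_jordan_ordering n) {\<sigma>. S * real v \<le> real (\<sigma> v)} \<le> 0" by simp
    also have "0 \<le> 100 / S" using S by simp
    finally show ?thesis .
  next
    case 2
    have "measure_pmf.prob (rrt_jordan_ordering n) {\<sigma>. S * real v \<le> real (\<sigma> v)} \<le> 1" by simp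
    also have "1 \<le> 100 / S" using S 2 by simp
    finally show ?thesis .
  next
    case 3
    have T: "100 \<le> T" "S \<le> T" "100 * real v \<le> T"
    proof -
      show "S \<le> T" using mult_left_mono[of 1 "real v" S] v S by (simp add: T_def)
      then show "100 \<le> T" using 3 by simp
      show "100 * real v \<le> T" using 3 mult_right_mono[of 100 S "real v"] by (simp add: T_def)
    qed
    \<comment> \<open>With this \<open>z\<close>, on average at most \<open>T / 4\<close> vertices have more than \<open>z\<close> descendants.\<close>
    define k where "k = nat \<lfloor>T / 4\<rfloor>"
    define z where "z = nat \<lceil>4 * real n / T\<rceil>"
    have k: "real k \<le> T / 4" "T / 8 \<le> real k" "1 \<le> k"
    proof -
      show k4: "real k \<le> T / 4" unfolding k_def using T by linarith
      have "T / 4 < real k + 1" unfolding k_def using T by linarith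
      then show k8: "T / 8 \<le> real k" using T by simp
      then show "1 \<le> k" using T by linarith
    qed
    have n: "100 \<le> real n" using T 3 by simp
    have z: "4 * real n / T \<le> real z" "real z \<le> 5 * real n / T" "1 \<le> z" "real z \<le> real n / 20"
    proof -
      show z4: "4 * real n / T \<le> real z" unfolding z_def by linarith
      have "real z < 4 * real n / T + 1"
        unfolding z_def using T by (simp add: of_nat_nat) linarith
      also have "1 \<le> real n / T" using 3 T by simp
      finally show z5: "real z \<le> 5 * real n / T" by (simp add: field_simps)
      have "0 < 4 * real n / T" using n T by simp
      then show "1 \<le> z" using z4 by linarith
      have "5 * real n / T \<le> 5 * real n / 100" using T n by (intro divide_left_mono) auto
      then show "real z \<le> real n / 20" using z5 by simp
    qed
    have zn: "z \<le> n - 1" "2 \<le> n" using z n by linarith+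
    define b where "b = real (n - 1) / real z"
    have b: "0 \<le> b" "b \<le> T / 4"
    proof -
      show "0 \<le> b" by (simp add: b_def)
      have "b \<le> real n / real z" unfolding b_def by (intro divide_right_mono) auto
      also have "\<dots> \<le> real n / (4 * real n / T)" using z T n by (intro divide_left_mono) auto
      also have "\<dots> = T / 4" using n T by simp
      finally show "b \<le> T / 4" .
    qed
    \<comment> \<open>\<open>A\<close> and \<open>B\<close> are the ways for the centrality of \<open>v\<close> to be at most \<open>z\<close>: too few descendants, or a child
      that leaves too few vertices outside its subtree; \<open>B\<close> ignores whose child it is.\<close>
    define A where "A f \<longleftrightarrow> v \<noteq> 1 \<and> desc_count f n v \<le> z" for f
    define B where "B f \<longleftrightarrow> (\<exists>c\<in>{2..n}. n - z - 1 < desc_count f n c)" for f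
    define C where "C f \<longleftrightarrow> T / 2 \<le> real (card {u\<in>{k<..n}. z < desc_count f n u})" for f
    have "measure_pmf.prob (rrt_jordan_ordering n) {\<sigma>. S * real v \<le> real (\<sigma> v)} \<le>
        expect (random_parents n) (\<lambda>f. of_bool (A f \<or> B f \<or> C f))"
    proof (rule prob_ordering_le[OF n1], rule ccontr)
      fix f \<sigma>
      assume f: "valid_parents n f"
        and \<sigma>: "\<sigma> \<in> rankings {1..n} (jordan_centrality (tree_of n f))" "S * real v \<le> real (\<sigma> v)"
        and no: "\<not> (A f \<or> B f \<or> C f)"
      let ?\<phi> = "jordan_centrality (tree_of n f)"
      have \<phi>v: "z < ?\<phi> v"
      proof (rule centrality_greaterI[OF f v zn(2)])
        show "v \<noteq> 1 \<Longrightarrow> z < desc_count f n v" using no by (auto simp: A_def)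
        fix c assume "c \<in> {2..n}" "f c = v"
        then have "desc_count f n c \<le> n - z - 1" using no by (auto simp: B_def not_less)
        then show "z < n - desc_count f n c" using zn by linarith
      qed
      have "{u\<in>{1..n}. ?\<phi> v \<le> ?\<phi> u} \<subseteq> {1..k} \<union> {u\<in>{k<..n}. z < desc_count f n u}"
      proof
        fix u assume u: "u \<in> {u\<in>{1..n}. ?\<phi> v \<le> ?\<phi> u}"
        show "u \<in> {1..k} \<union> {u\<in>{k<..n}. z < desc_count f n u}"
        proof (cases "u \<le> k")
          case False
          then have "u \<in> {2..n}" using u k(3) by auto
          then have "z < desc_count f n u" using centrality_le_desc[OF f] u \<phi>v by fastforce
          then show ?thesis using False u by auto
        qed (use u in auto)
      qed
      then have "card {u\<in>{1..n}. ?\<phi> v \<le> ?\<phi> u} \<le> card ({1..k} \<union> {u\<in>{k<..n}. z < desc_count f n u})"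
        by (intro card_mono) auto
      also have "\<dots> \<le> k + card {u\<in>{k<..n}. z < desc_count f n u}"
        using card_Un_le[of "{1..k}" "{u\<in>{k<..n}. z < desc_count f n u}"] by simp
      finally have "\<sigma> v \<le> k + card {u\<in>{k<..n}. z < desc_count f n u}"
        using card_rank_le[OF \<sigma>(1) _ v] by simp
      then have "real (\<sigma> v) \<le> real k + real (card {u\<in>{k<..n}. z < desc_count f n u})"
        by (metis of_nat_add of_nat_le_iff)
      also have "\<dots> < T" using no k T by (simp add: C_def)
      finally show False using \<sigma>(2) by (simp add: T_def)
    qed
    also have "\<dots> \<le> expect (random_parents n) (\<lambda>f. of_bool (A f)) + (expect (random_parents n) (\<lambda>f. of_bool (B f))
        + expect (random_parents n) (\<lambda>f. of_bool (C f)))"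
      using expect_disj_le[of "random_parents n" A "\<lambda>f. B f \<or> C f"] expect_disj_le[of "random_parents n" B C] by simp
    also have "expect (random_parents n) (\<lambda>f. of_bool (A f)) \<le> 10 / S"
    proof (cases "v = 1")
      case True
      then show ?thesis using S by (simp add: A_def)
    next
      case False
      then have v2: "2 \<le> v" "v \<le> n" using v by auto
      have "expect (random_parents n) (\<lambda>f. of_bool (A f)) = expect (random_parents n) (\<lambda>f. 1 - of_bool (z < desc_count f n v))"
        using False by (intro expect_cong) (auto simp: A_def not_less)
      also have "\<dots> = 1 - tail v n z" using expect_random_parents_desc_tail[OF v2] by (simp add: expect_diff)
      also have "\<dots> \<le> real z * real (v - 1) / real (n - v + 1)" by (rule one_minus_tail_le[OF v2])
      also have "\<dots> \<le> (5 * real n / T) * real v / (real n / 2)"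
      proof (rule frac_le)
        show "real z * real (v - 1) \<le> 5 * real n / T * real v" using z by (intro mult_mono) auto
        show "real n / 2 \<le> real (n - v + 1)" using T 3 v2 by (simp add: of_nat_diff)
      qed (use n T in auto)
      also have "\<dots> = 10 / S" using n v2 S by (simp add: T_def)
      finally show ?thesis .
    qed
    also have "expect (random_parents n) (\<lambda>f. of_bool (B f)) \<le> 20 / S"
    proof -
      define x where "x = real z / real (n - 1)"
      have x: "0 \<le> x" "x \<le> 1 / 2" "x \<le> 10 / T"
      proof -
        show "0 \<le> x" by (simp add: x_def)
        have "x \<le> real z / (real n / 2)" unfolding x_def using n zn by (intro divide_left_mono) (auto simp: of_nat_diff)
        also have "\<dots> \<le> (5 * real n / T) / (real n / 2)" using z by (intro divide_right_mono) auto
        also have "\<dots> = 10 / T" using n by simp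
        finally show xT: "x \<le> 10 / T" .
        also have "10 / T \<le> 1 / 2" using T by simp
        finally show "x \<le> 1 / 2" .
      qed
      have "expect (random_parents n) (\<lambda>f. of_bool (B f)) \<le>
          (\<Sum>c\<in>{2..n}. expect (random_parents n) (\<lambda>f. of_bool (n - z - 1 < desc_count f n c)))"
        unfolding B_def by (rule expect_ex_le) auto
      also have "\<dots> = (\<Sum>c\<in>{2..n}. tail c n (n - z - 1))"
        by (intro sum.cong expect_random_parents_desc_tail) auto
      also have "\<dots> \<le> (\<Sum>c\<in>{2..n}. x ^ (c - 1))"
      proof (rule sum_mono)
        fix c assume c: "c \<in> {2..n}"
        have "1 - real (n - z - 1) / real (n - 1) = x"
          using zn by (simp add: x_def field_simps of_nat_diff)
        then show "tail c n (n - z - 1) \<le> x ^ (c - 1)"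
          using tail_le_power[of c n "n - z - 1"] c by simp
      qed
      also have "\<dots> = x * (\<Sum>i<n - 1. x ^ i)"
        unfolding sum_distrib_left
        by (rule sum.reindex_bij_witness[where i = "\<lambda>i. i + 2" and j = "\<lambda>c. c - 2"])
           (auto simp: power_Suc[symmetric] Suc_diff_Suc numeral_2_eq_2 simp del: power_Suc)
      also have "\<dots> \<le> x * (1 / (1 - x))" using x by (intro mult_left_mono sum_geometric_le) auto
      also have "\<dots> \<le> x * 2" using x by (intro mult_left_mono) (auto simp: field_simps)
      also have "\<dots> \<le> 20 / T" using x by simp
      also have "\<dots> \<le> 20 / S" using T S by (intro divide_left_mono) auto
      finally show ?thesis .
    qed
    also have "expect (random_parents n) (\<lambda>f. of_bool (C f)) \<le> 20 / S"
    proof -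
      have "expect (random_parents n) (\<lambda>f. of_bool (C f)) \<le> (b + 2 / real k * b\<^sup>2) / (T / 2 - b)\<^sup>2"
      proof -
        have "b < T / 2" using b T by simp
        then show ?thesis
          unfolding C_def b_def using prob_count_large_le[OF zn(2) z(3) zn(1) k(3)] by blast
      qed
      also have "\<dots> \<le> (T / 4 + 2 / (T / 8) * (T / 4)\<^sup>2) / (T / 4)\<^sup>2"
      proof (rule frac_le)
        show "b + 2 / real k * b\<^sup>2 \<le> T / 4 + 2 / (T / 8) * (T / 4)\<^sup>2"
          using b k T by (intro add_mono mult_mono power_mono divide_left_mono) auto
        show "(T / 4)\<^sup>2 \<le> (T / 2 - b)\<^sup>2" using b T by (intro power_mono) auto
      qed (use T in auto)
      also have "\<dots> = 20 / T" using T by (simp add: power2_eq_square field_simps)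
      also have "\<dots> \<le> 20 / S" using T S by (intro divide_left_mono) auto
      finally show ?thesis .
    qed
    finally have "measure_pmf.prob (rrt_jordan_ordering n) {\<sigma>. S * real v \<le> real (\<sigma> v)} \<le>
      10 / S + (20 / S + 20 / S)" by simp
    also have "\<dots> \<le> 100 / S" using S by (simp add: field_simps)
    finally show ?thesis .
  qed
qed

text \<open>On average at most a fraction \<open>q = 1 - tail M n z\<close> of the blocks is small, and negative dependence keeps
  this bound valid when the block of \<open>v\<close> is required to be small as well. Markov's inequality at the level
  \<open>3 M / 4\<close> leaves at least the fraction \<open>1 - 4 q / 3 \<ge> 1 / 2\<close> of the probability \<open>q\<close>.\<close>

lemma expect_small_block_few_small:
  assumes f: "valid_parents M f" "8 \<le> M" "M \<le> n" and v: "v \<in> {1..M}"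
    and q: "1 - tail M n z \<le> 1 / 8"
  shows "(1 - tail M n z) / 2 \<le> expect (grow M (n - M) f) (\<lambda>g. of_bool (mass g M {v} n \<le> z \<and>
      real (card {u\<in>{1..M} - {v}. mass g M {u} n \<le> z}) < 3 * real M / 4))"
proof -
  let ?p = "grow M (n - M) f" and ?I = "{1..M} - {v}"
  define q where "q = 1 - tail M n z"
  have fin: "finite (set_pmf ?p)" using f by simp
  have q01: "0 \<le> q" "q \<le> 1 / 8" using tail_le_1[of M n z] f q by (auto simp: q_def)
  let ?X = "\<lambda>g u. of_bool (mass g M {u} n \<le> z) :: real"
  have pair: "expect ?p (\<lambda>g. of_bool (mass g M {v} n \<le> z \<and> mass g M {u} n \<le> z)) \<le> q\<^sup>2" if "u \<in> ?I" for u
    using expect_all_blocks_small_le[OF f(1) _ f(3), of "{v, u}" z] that v f(2)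
    by (simp add: q_def power2_eq_square)
  have "q / 2 \<le> q - 4 / (3 * real M) * (real M * q\<^sup>2)"
    using q01 f(2) by (simp add: power2_eq_square field_simps) (use mult_left_mono[of q "1/8" q] in auto)
  also have "real M * q\<^sup>2 \<ge> (\<Sum>u\<in>?I. q\<^sup>2)"
    using v by (simp add: mult_right_mono)
  then have "q - 4 / (3 * real M) * (real M * q\<^sup>2) \<le>
      q - 4 / (3 * real M) * (\<Sum>u\<in>?I. expect ?p (\<lambda>g. of_bool (mass g M {v} n \<le> z \<and> mass g M {u} n \<le> z)))"
    using sum_mono[of ?I "\<lambda>u. expect ?p (\<lambda>g. of_bool (mass g M {v} n \<le> z \<and> mass g M {u} n \<le> z))" "\<lambda>_. q\<^sup>2"] pair
    by (intro diff_left_mono mult_left_mono) force+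
  also have "\<dots> = expect ?p (\<lambda>g. ?X g v - 4 / (3 * real M) *
      (\<Sum>u\<in>?I. of_bool (mass g M {v} n \<le> z \<and> mass g M {u} n \<le> z)))"
    unfolding expect_diff[OF fin] integral_mult_right_zero expect_sum[OF fin]
    using expect_block_small[OF f(1) _ f(3) v] f(2) by (simp add: q_def)
  also have "\<dots> \<le> expect ?p (\<lambda>g. of_bool (mass g M {v} n \<le> z \<and>
      real (card {u\<in>?I. mass g M {u} n \<le> z}) < 3 * real M / 4))"
  proof (rule expect_mono[OF fin])
    fix g
    have "(\<Sum>u\<in>?I. of_bool (mass g M {v} n \<le> z \<and> mass g M {u} n \<le> z)) =
        of_bool (mass g M {v} n \<le> z) * real (card {u\<in>?I. mass g M {u} n \<le> z})"
      by (subst card_eq_sum_of_bool) (auto simp: sum_distrib_left of_bool_conj)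
    moreover have "1 \<le> 4 / (3 * real M) * c" if "\<not> c < 3 * real M / 4" for c :: real
      using that f(2) by (simp add: field_simps)
    moreover have "0 \<le> 4 / (3 * real M) * real c" for c using f(2) by simp
    ultimately show "?X g v - 4 / (3 * real M) *
        (\<Sum>u\<in>?I. of_bool (mass g M {v} n \<le> z \<and> mass g M {u} n \<le> z)) \<le>
      of_bool (mass g M {v} n \<le> z \<and> real (card {u\<in>?I. mass g M {u} n \<le> z}) < 3 * real M / 4)"
      by (cases "mass g M {v} n \<le> z"; cases "real (card {u\<in>?I. mass g M {u} n \<le> z}) < 3 * real M / 4") auto
  qed
  finally show ?thesis by (simp add: q_def)
qed

text \<open>With \<open>M\<close> of order \<open>S v\<close>, the probability that \<open>v\<close> acquires no descendant between the times \<open>m\<close> and \<open>M\<close> is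
  already of the right order \<open>1 / S\<close>. The remaining event has a probability bounded from below: the block of
  \<open>v\<close> is small and at least a quarter of the \<open>M\<close> blocks, up to one, is large.\<close>

lemma rank_upper_tail_ge:
  fixes S :: real
  assumes v: "v \<in> {1..n}" and S: "1 \<le> S" "S \<le> 1 / 1000 * real n / real v"
  shows "1 / 10000 / S \<le> measure_pmf.prob (rrt_jordan_ordering n) {\<sigma>. S * real v \<le> real (\<sigma> v)}"
proof -
  define T where "T = S * real v"
  define m where "m = max v 2"
  \<comment> \<open>The factor \<open>8\<close> makes \<open>M / 4 - 1\<close> large blocks enough to beat \<open>T\<close>, and \<open>z\<close> is about a sixteenth of the
    average block size \<open>n / M\<close>.\<close>
  define M where "M = nat \<lceil>8 * T\<rceil>"
  define z where "z = n div (16 * M)"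
  have v0: "1 \<le> real v" using v by simp
  have T: "1 \<le> T" "real v \<le> T" "1000 * T \<le> real n"
  proof -
    show "real v \<le> T" using S(1) mult_right_mono[of 1 S "real v"] by (simp add: T_def)
    then show "1 \<le> T" using v0 by simp
    show "1000 * T \<le> real n" using S(2) v0 by (simp add: T_def field_simps)
  qed
  have M: "8 * T \<le> real M" "real M \<le> 9 * T" "8 \<le> M"
  proof -
    show M8: "8 * T \<le> real M" unfolding M_def by linarith
    show "real M \<le> 9 * T" unfolding M_def using T by linarith
    show "8 \<le> M" using M8 T by linarith
  qed
  have Mn: "100 * real M \<le> real n" using M T by simp
  have mM: "v \<le> m" "2 \<le> m" "m \<le> M" "M \<le> n" using M T Mn by (auto simp: m_def)
  have zeq: "real z * (16 * real M) \<le> real n" "real n < (real z + 1) * (16 * real M)"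
    using real_div_bounds[of "16 * M" n] M by (simp_all add: z_def)
  have zM: "real n / 32 \<le> real z * real M" "real z * real M \<le> real n / 16"
    using zeq Mn by (auto simp: algebra_simps)
  have zn: "z \<le> n - 1" "2 \<le> n"
  proof -
    show n2: "2 \<le> n" using Mn M(3) by linarith
    have "real z * 8 \<le> real z * real M" using M(3) by (intro mult_left_mono) auto
    then have "real z \<le> real n / 2" using zM by simp
    then show "z \<le> n - 1" using n2 by linarith
  qed
  define q where "q = 1 - tail M n z"
  have q: "q \<le> 1 / 8" "1 / 128 \<le> q"
  proof -
    have "q \<le> real z * real (M - 1) / real (n - M + 1)"
      unfolding q_def using mM by (intro one_minus_tail_le) auto
    also have "\<dots> \<le> (real z * real M) / (real n / 2)"
      using mM Mn zn by (intro frac_le mult_left_mono) (auto simp: of_nat_diff)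
    also have "\<dots> \<le> (real n / 16) / (real n / 2)" using zM by (intro divide_right_mono) auto
    also have "\<dots> = 1 / 8" using zn by simp
    finally show "q \<le> 1 / 8" .
    define s where "s = real z * real (M - 1) / real (n - 1)"
    have "s \<le> (real n / 16) / (real n / 2)"
      unfolding s_def using zM zn M(3)
      by (intro frac_le order_trans[OF mult_left_mono[of "real (M - 1)" "real M"] zM(2)]) (auto simp: of_nat_diff)
    also have "\<dots> \<le> 1" using zn by simp
    finally have s1: "s \<le> 1" .
    have "1 / 64 = (real n / 32) / 2 / real n" using zn by simp
    also have "\<dots> \<le> (real z * real M) / 2 / real n" using zM by (intro divide_right_mono) auto
    also have "\<dots> \<le> (real z * real (M - 1)) / real (n - 1)"
    proof (rule frac_le)
      have "real M / 2 \<le> real (M - 1)" using M(3) by (simp add: of_nat_diff)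
      then show "real z * real M / 2 \<le> real z * real (M - 1)"
        using mult_left_mono[of "real M / 2" "real (M - 1)" "real z"] by simp
    qed (use zn in auto)
    finally have "1 / 64 \<le> s" by (simp add: s_def)
    then show "1 / 128 \<le> q"
    proof -
      have "s / 2 \<le> q"
        unfolding s_def q_def using mM zn s1 by (intro one_minus_tail_lower) (auto simp: s_def)
      then show ?thesis using \<open>1 / 64 \<le> s\<close> by linarith
    qed
  qed
  \<comment> \<open>The first condition says that at time \<open>M\<close> the block of \<open>v\<close> still consists of \<open>v\<close> alone.\<close>
  define P where "P g \<longleftrightarrow> mass g m {v} M \<le> 1 \<and> mass g M {v} n \<le> z \<and>
      real (card {u\<in>{1..M} - {v}. mass g M {u} n \<le> z}) < 3 * real M / 4" for g
  have "expect (random_parents n) (\<lambda>g. of_bool (P g)) \<le>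
      measure_pmf.prob (rrt_jordan_ordering n) {\<sigma>. S * real v \<le> real (\<sigma> v)}"
  proof (rule prob_ordering_ge)
    fix g \<sigma>
    assume g: "valid_parents n g" and P: "P g"
      and \<sigma>: "\<sigma> \<in> rankings {1..n} (jordan_centrality (tree_of n g))"
    define D where "D = {w\<in>{1..M}. block g m w \<in> {v}}"
    have "v \<in> D" using mM v by (simp add: D_def)
    moreover have "card D \<le> 1" using P by (simp add: P_def mass_def D_def)
    moreover have "finite D" by (simp add: D_def)
    ultimately have D: "D = {v}" using card_le_Suc0_iff_eq[of D] by auto
    have "jordan_centrality (tree_of n g) v \<le> mass g m {v} n"
      unfolding m_def by (rule centrality_le_mass[OF g v zn(2)])
    also have "\<dots> = mass g M {v} n"
      using mass_refine[OF g _ mM(3), of "{v}"] mM D by (simp add: D_def)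
    also have "\<dots> \<le> z" using P by (simp add: P_def)
    finally have \<phi>v: "jordan_centrality (tree_of n g) v \<le> z" .
    define I where "I = {1..M} - {v}"
    define B where "B = {u\<in>I. mass g M {u} n \<le> z}"
    have I: "finite I" "B \<subseteq> I" "card I = M - 1" using mM v by (auto simp: I_def B_def)
    have "card (I - B) = (M - 1) - card B" using I finite_subset by (metis card_Diff_subset)
    moreover have "real (card B) < 3 * real M / 4" using P by (simp add: P_def B_def I_def)
    ultimately have big: "real M / 4 - 1 < real (card (I - B))" using M(3) by linarith
    then have "2 \<le> card (I - B)" using M(3) by linarith
    moreover have "I - B \<subseteq> {u\<in>{1..M}. z < mass g M {u} n}" by (auto simp: I_def B_def)
    ultimately have "card (I - B) < \<sigma> v"
      using rank_greater_if_large_blocks[OF g v mM(4) _ _ \<phi>v \<sigma>] by blast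
    then have "real M / 4 < real (\<sigma> v)" using big by linarith
    then show "S * real v \<le> real (\<sigma> v)" using M T by (simp add: T_def[symmetric])
  qed (use zn in simp)
  moreover have "1 / 10000 / S \<le> expect (random_parents n) (\<lambda>g. of_bool (P g))"
  proof -
    have m1: "1 \<le> m" "m \<le> M" "1 \<le> M" using mM by auto
    have "expect (random_parents M) (\<lambda>f. of_bool (mass f m {v} M \<le> 1) * (q / 2)) \<le>
        expect (random_parents M) (\<lambda>f. expect (grow M (n - M) f) (\<lambda>g. of_bool (P g)))"
    proof (rule expect_mono)
      fix f assume "f \<in> set_pmf (random_parents M)"
      then have f: "valid_parents M f" using random_parents_valid m1 by simp
      show "of_bool (mass f m {v} M \<le> 1) * (q / 2) \<le> expect (grow M (n - M) f) (\<lambda>g. of_bool (P g))"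
      proof (cases "mass f m {v} M \<le> 1")
        case True
        have "expect (grow M (n - M) f) (\<lambda>g. of_bool (P g)) =
          expect (grow M (n - M) f) (\<lambda>g. of_bool (mass g M {v} n \<le> z \<and>
            real (card {u\<in>{1..M} - {v}. mass g M {u} n \<le> z}) < 3 * real M / 4))"
        proof (rule expect_cong)
          fix g assume "g \<in> set_pmf (grow M (n - M) f)"
          then have "\<And>i. i \<le> M \<Longrightarrow> g i = f i" using grow_valid(2)[OF f _ mM(4)] m1 by blast
          then have "mass g m {v} M = mass f m {v} M"
            unfolding mass_def using block_cong[of _ g f m] by (intro arg_cong[where f = card]) auto
          then show "of_bool (P g) = (of_bool (mass g M {v} n \<le> z \<and>
            real (card {u\<in>{1..M} - {v}. mass g M {u} n \<le> z}) < 3 * real M / 4) :: real)"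
            using True by (simp add: P_def)
        qed
        then show ?thesis using expect_small_block_few_small[OF f M(3) mM(4), of v z] True q mM v
          by (simp add: q_def)
      qed simp
    qed simp
    then have E: "expect (random_parents M) (\<lambda>f. of_bool (mass f m {v} M \<le> 1)) * (q / 2) \<le> expect (random_parents n) (\<lambda>g. of_bool (P g))"
      using expect_random_parents_split[OF m1(3) mM(4)] by (simp only: integral_mult_left_zero)
    have "expect (random_parents M) (\<lambda>f. of_bool (mass f m {v} M \<le> 1)) =
        expect (random_parents m) (\<lambda>_. 1 - tail m M 1)"
      unfolding expect_random_parents_split[OF m1(1,2)] using random_parents_valid[OF m1(1)] mM v
      by (intro expect_cong expect_block_small) auto
    then have alone: "expect (random_parents M) (\<lambda>f. of_bool (mass f m {v} M \<le> 1)) = 1 - tail m M 1" by simp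
    have "1 / (18 * S) = (real v / 2) / (9 * T)" using v0 S by (simp add: T_def)
    also have "\<dots> \<le> real 1 * real (m - 1) / real (M - 1)"
      unfolding of_nat_1 mult_1
    proof (rule frac_le)
      show "real v / 2 \<le> real (m - 1)" using v0 by (simp add: m_def of_nat_diff max_def)
      show "real (M - 1) \<le> 9 * T" using M m1 by (simp add: of_nat_diff)
    qed (use M in auto)
    finally have s: "1 / (18 * S) \<le> real 1 * real (m - 1) / real (M - 1)" .
    have "real 1 * real (m - 1) / real (M - 1) / 2 \<le> 1 - tail m M 1"
      using mM M(3) by (intro one_minus_tail_lower) (auto simp: divide_le_eq_1)
    then have "1 / (36 * S) \<le> 1 - tail m M 1" using s by simp
    then have "1 / (36 * S) * (1 / 256) \<le> (1 - tail m M 1) * (q / 2)"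
      using q S tail_le_1[of m M 1] mM by (intro mult_mono) auto
    then have "1 / (36 * S) * (1 / 256) \<le> expect (random_parents n) (\<lambda>g. of_bool (P g))"
      using E alone by simp
    moreover have "1 / 10000 / S \<le> 1 / (36 * S) * (1 / 256)" using S by (simp add: field_simps)
    ultimately show ?thesis by linarith
  qed
  ultimately show ?thesis by linarith
qed

text \<open>If \<open>D v \<le> z\<close> and more than half of the \<open>M\<close> blocks of time \<open>M\<close> have more than \<open>z\<close> elements, then more than
  \<open>v / S\<close> vertices are ranked before \<open>v\<close>.\<close>

lemma rank_lower_tail_le:
  fixes S :: real
  assumes v: "v \<in> {1..n}" and S: "1 \<le> S" "S \<le> sqrt (real v)"
  shows "measure_pmf.prob (rrt_jordan_ordering n) {\<sigma>. real (\<sigma> v) \<le> 1 / S * real v}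
    \<le> 2 * exp (- (1 / 512) * S)"
proof (cases "S \<le> 128")
  case True
  have "measure_pmf.prob (rrt_jordan_ordering n) {\<sigma>. real (\<sigma> v) \<le> 1 / S * real v} \<le> 1" by simp
  also have "1 \<le> 2 * (1 + - (1 / 512) * S)" using True by simp
  also have "\<dots> \<le> 2 * exp (- (1 / 512) * S)" by (intro mult_left_mono exp_ge_add_one_self) auto
  finally show ?thesis .
next
  case False
  then have S128: "128 < S" by simp
  define R where "R = real v / S"
  have Sv: "S * S \<le> real v"
    using S mult_mono[OF S(2) S(2)] by simp
  have R: "S \<le> R" "S * R = real v" "R \<le> real v / 128"
  proof -
    show SR: "S * R = real v" using S by (simp add: R_def)
    show "S \<le> R" using Sv S by (simp add: R_def field_simps)
    show "R \<le> real v / 128" unfolding R_def using S128 by (intro divide_left_mono) auto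
  qed
  \<comment> \<open>With \<open>M = 4 * K\<close> and this \<open>z\<close>, a block is small with probability at most \<open>1 / 16\<close>, which beats the number
    \<open>2 ^ M\<close> of sets of blocks.\<close>
  define K where "K = nat \<lfloor>R\<rfloor>"
  define M where "M = 4 * K"
  define z where "z = n div (32 * M)"
  have K: "real K \<le> R" "R < real K + 1" "100 \<le> K"
  proof -
    show KR: "real K \<le> R" unfolding K_def using R S128 by linarith
    show RK: "R < real K + 1" unfolding K_def using R S128 by linarith
    then show "100 \<le> K" using R S128 by linarith
  qed
  have vn: "v \<le> n" "2 \<le> v" using v R(3) K by auto
  have Mn: "32 * real M \<le> real n" using K R vn by (simp add: M_def)
  have M: "2 \<le> M" "M \<le> n" "1 \<le> M" using K Mn by (auto simp: M_def)
  have zeq: "real z * (32 * real M) \<le> real n" "real n < (real z + 1) * (32 * real M)"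
    using real_div_bounds[of "32 * M" n] M by (simp_all add: z_def)
  have z1: "1 \<le> z"
  proof (rule ccontr)
    assume "\<not> 1 \<le> z"
    then have "z = 0" by simp
    then show False using zeq(2) Mn by simp
  qed
  have zM: "real n / 64 \<le> real z * real M" "real z * real M \<le> real n / 32"
  proof -
    have "real M \<le> real z * real M" using z1 mult_right_mono[of 1 "real z" "real M"] by simp
    moreover have "real n < 32 * (real z * real M) + 32 * real M" using zeq(2) by (simp add: algebra_simps)
    ultimately show "real n / 64 \<le> real z * real M" by linarith
    show "real z * real M \<le> real n / 32" using zeq by simp
  qed
  have zn: "z \<le> n - 1" "2 \<le> n"
  proof -
    show n2: "2 \<le> n" using vn by simp
    have "real z * 1 \<le> real z * real M" using M(3) by (intro mult_left_mono) auto
    then have "real z \<le> real n / 2" using zM by simp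
    then show "z \<le> n - 1" using n2 by linarith
  qed
  define C where "C g \<longleftrightarrow> 2 * K \<le> card {u\<in>{1..M}. mass g M {u} n \<le> z}" for g
  have "measure_pmf.prob (rrt_jordan_ordering n) {\<sigma>. real (\<sigma> v) \<le> 1 / S * real v} \<le>
      expect (random_parents n) (\<lambda>g. of_bool (z < desc_count g n v \<or> C g))"
  proof (rule prob_ordering_le, use vn in simp, rule ccontr)
    fix g \<sigma>
    assume g: "valid_parents n g"
      and \<sigma>: "\<sigma> \<in> rankings {1..n} (jordan_centrality (tree_of n g))" "real (\<sigma> v) \<le> 1 / S * real v"
      and no: "\<not> (z < desc_count g n v \<or> C g)"
    have \<phi>v: "jordan_centrality (tree_of n g) v \<le> z"
      using centrality_le_desc[OF g, of v] vn no by simp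
    define B where "B = {u\<in>{1..M}. mass g M {u} n \<le> z}"
    have "card ({1..M} - B) = M - card B" by (subst card_Diff_subset) (auto simp: B_def)
    moreover have "card B < 2 * K" using no by (simp add: C_def B_def)
    ultimately have big: "2 * K < card ({1..M} - B)" by (simp add: M_def)
    moreover have "{1..M} - B \<subseteq> {u\<in>{1..M}. z < mass g M {u} n}" by (auto simp: B_def)
    ultimately have "card ({1..M} - B) < \<sigma> v"
      using rank_greater_if_large_blocks[OF g v M(2) _ _ \<phi>v \<sigma>(1), of "{1..M} - B"] K by simp
    then have "real K + 1 \<le> real (\<sigma> v)" using big by linarith
    then show False using \<sigma>(2) K by (simp add: R_def)
  qed
  also have "\<dots> \<le> expect (random_parents n) (\<lambda>g. of_bool (z < desc_count g n v)) + expect (random_parents n) (\<lambda>g. of_bool (C g))"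
    by (rule expect_disj_le) simp
  also have "expect (random_parents n) (\<lambda>g. of_bool (z < desc_count g n v)) \<le> exp (- (1 / 512) * S)"
  proof -
    define x where "x = real z / real (n - 1)"
    have x: "x \<le> 1" using zn by (simp add: x_def)
    have "expect (random_parents n) (\<lambda>g. of_bool (z < desc_count g n v)) = tail v n z"
      by (rule expect_random_parents_desc_tail[OF vn(2,1)])
    also have "\<dots> \<le> (1 - x) ^ (v - 1)" unfolding x_def using vn zn by (intro tail_le_power) auto
    also have "\<dots> \<le> exp (- (real (v - 1) * x))" by (rule power_one_minus_le_exp[OF x])
    also have "\<dots> \<le> exp (- (1 / 512) * S)"
    proof -
      have "S * real M * real n \<le> (4 * real v) * (64 * (real z * real M))"
      proof (rule mult_mono)
        have "S * real K \<le> S * R" using K S by (intro mult_left_mono) auto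
        then show "S * real M \<le> 4 * real v" using R by (simp add: M_def)
      qed (use zM in auto)
      then have "(S * real n) * real M \<le> (256 * real v * real z) * real M" by (simp add: algebra_simps)
      then have "S * real n \<le> 256 * real v * real z" using M(3) by simp
      also have "\<dots> \<le> 512 * real (v - 1) * real z" using vn by (intro mult_right_mono) auto
      finally have "S * real n \<le> 512 * real (v - 1) * real z" .
      moreover have "S * real (n - 1) \<le> S * real n" using S by (intro mult_left_mono) auto
      ultimately have "S * real (n - 1) \<le> 512 * real (v - 1) * real z" by linarith
      then have "S / 512 \<le> real (v - 1) * x" using zn by (simp add: x_def field_simps)
      then show ?thesis by simp
    qed
    finally show ?thesis .
  qed
  also have "expect (random_parents n) (\<lambda>g. of_bool (C g)) \<le> exp (- (1 / 512) * S)"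
  proof -
    define q where "q = 1 - tail M n z"
    have "q \<le> real z * real (M - 1) / real (n - M + 1)"
      unfolding q_def using M by (intro one_minus_tail_le) auto
    also have "\<dots> \<le> (real z * real M) / (real n / 2)"
      using M Mn zn by (intro frac_le mult_left_mono) (auto simp: of_nat_diff)
    also have "\<dots> \<le> (real n / 32) / (real n / 2)" using zM by (intro divide_right_mono) auto
    also have "\<dots> = 1 / 16" using zn by simp
    finally have q: "0 \<le> q" "q \<le> 1 / 16" using tail_le_1[of M n z] M by (auto simp: q_def)
    have "expect (random_parents n) (\<lambda>g. of_bool (C g)) \<le> expect (random_parents M) (\<lambda>_. 2 ^ M * q ^ (2 * K))"
      unfolding expect_random_parents_split[OF M(3,2)] C_def q_def
      using random_parents_valid[OF M(3)] M by (intro expect_mono expect_many_small_blocks_le) auto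
    also have "\<dots> \<le> 2 ^ M * (1 / 16) ^ (2 * K)"
      using q by (simp add: power_mono)
    also have "\<dots> = (1 / 16) ^ K"
    proof -
      have base: "(2::real) ^ 4 * (1 / 16) ^ 2 = 1 / 16" by (simp add: power2_eq_square)
      show ?thesis unfolding M_def power_mult power_mult_distrib[symmetric] base ..
    qed
    also have "\<dots> \<le> exp (- 1) ^ K"
    proof (rule power_mono)
      show "1 / 16 \<le> exp (- 1 :: real)" using exp_le by (simp add: exp_minus field_simps)
    qed simp
    also have "\<dots> = exp (- real K)" by (simp add: exp_of_nat_mult[symmetric])
    also have "\<dots> \<le> exp (- (1 / 512) * S)" using K R by simp
    finally show ?thesis .
  qed
  finally show ?thesis by simp
qed

text \<open>Only the vertices up to \<open>k\<close>, the vertex \<open>v\<close>, and the vertices counted by \<open>D\<close> and \<open>N\<close> can be ranked no later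
  than \<open>v\<close>. Descendants of \<open>v\<close> must be excluded altogether, since a child of \<open>v\<close> carrying almost the whole
  tree would lower the centrality of \<open>v\<close>. Ancestors of \<open>v\<close> beyond \<open>k\<close> do not exist when its parent is at most \<open>k\<close>;
  without this condition their number, about \<open>ln S\<close>, would not be small compared to \<open>v / S\<close> when \<open>S\<close> is of order
  \<open>v\<close>.\<close>

lemma rank_lower_tail_ge:
  fixes S :: real
  assumes v: "v \<in> {1..n}" "real v \<le> real n / 2" and S: "1 \<le> S" "S \<le> 1 / 128 * real v"
  shows "1 / 16 * exp (- 69 * S) \<le>
    measure_pmf.prob (rrt_jordan_ordering n) {\<sigma>. real (\<sigma> v) \<le> 1 / S * real v}"
proof -
  define R where "R = real v / S"
  have R: "128 \<le> R" "S * R = real v" "R \<le> real v"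
  proof -
    show SR: "S * R = real v" using S by (simp add: R_def)
    show "128 \<le> R" using S by (simp add: R_def field_simps)
    show "R \<le> real v" unfolding R_def using S by (simp add: field_simps mult_left_mono[of 1 S, simplified])
  qed
  have n: "256 \<le> real n" "2 * v \<le> n" "2 \<le> v" "v \<le> n" "2 \<le> n" "1 \<le> v" using v R by auto
  \<comment> \<open>With this \<open>z\<close>, on average at most \<open>R / 16\<close> vertices beyond \<open>k\<close> have more than \<open>z\<close> descendants; \<open>N\<close> may
    count up to \<open>R / 4\<close> of them.\<close>
  define k where "k = nat \<lfloor>R / 4\<rfloor>"
  define z where "z = nat \<lceil>16 * real n / R\<rceil>"
  have k: "real k \<le> R / 4" "R / 8 \<le> real k" "1 \<le> k" "k \<le> v - 1" "k < v"
  proof -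
    show k4: "real k \<le> R / 4" unfolding k_def using R by linarith
    have "R / 4 < real k + 1" unfolding k_def using R by linarith
    then show k8: "R / 8 \<le> real k" using R by linarith
    then show "1 \<le> k" using R by linarith
    have "real k \<le> real v / 4" using k4 R by linarith
    then show "k < v" using n by linarith
    then show "k \<le> v - 1" by simp
  qed
  have z: "16 * real n / R \<le> real z" "real z \<le> 17 * real n / R" "1 \<le> z" "real z \<le> 17 * real n / 128"
  proof -
    show z16: "16 * real n / R \<le> real z" unfolding z_def by linarith
    have "0 \<le> 16 * real n / R" using R by simp
    then have "real z < 16 * real n / R + 1" unfolding z_def by linarith
    also have "1 \<le> real n / R" using R n by (simp add: field_simps)
    finally show z17: "real z \<le> 17 * real n / R" by (simp add: field_simps)
    have "0 < 16 * real n / R" using R n by simp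
    then show "1 \<le> z" using z16 by linarith
    have "17 * real n / R \<le> 17 * real n / 128" using R n by (intro divide_left_mono) auto
    then show "real z \<le> 17 * real n / 128" using z17 by simp
  qed
  have zn: "z \<le> n - 1" "2 * z < n" using z(4) n by linarith+
  define b where "b = real (n - 1) / real z"
  have b: "0 \<le> b" "b \<le> R / 16"
  proof -
    show "0 \<le> b" by (simp add: b_def)
    have "b \<le> real n / real z" unfolding b_def by (intro divide_right_mono) auto
    also have "\<dots> \<le> real n / (16 * real n / R)" using z R n by (intro divide_left_mono) auto
    also have "\<dots> = R / 16" using n by simp
    finally show "b \<le> R / 16" .
  qed
  \<comment> \<open>The main event, that the parent of \<open>v\<close> is at most \<open>k\<close> and \<open>v\<close> has more than \<open>z\<close> descendants, has
    probability \<open>\<pi> * p\<close>.\<close>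
  define p where "p = tail v n z"
  define \<pi> where "\<pi> = real k / real (v - 1)"
  have p0: "0 \<le> p" by (simp add: p_def tail_nonneg)
  have \<pi>0: "0 \<le> \<pi>" by (simp add: \<pi>_def)
  let ?J = "{k<..n} - {v}"
  define D where "D g u \<longleftrightarrow> g v \<le> k \<and> u \<in> desc g n v \<and> z < desc_count g n u" for g u
  define N where "N g u \<longleftrightarrow> g v \<le> k \<and> z < desc_count g n v \<and> u \<notin> desc g n v \<and> z < desc_count g n u" for g u
  define P where "P g \<longleftrightarrow> g v \<le> k \<and> z < desc_count g n v \<and> \<not> (\<exists>u\<in>{v<..n}. D g u)
    \<and> real (card {u\<in>?J. N g u}) < R / 4" for g
  have "expect (random_parents n) (\<lambda>g. of_bool (P g)) \<le>
      measure_pmf.prob (rrt_jordan_ordering n) {\<sigma>. real (\<sigma> v) \<le> 1 / S * real v}"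
  proof (rule prob_ordering_ge)
    fix g \<sigma>
    assume g: "valid_parents n g" and P: "P g"
      and \<sigma>: "\<sigma> \<in> rankings {1..n} (jordan_centrality (tree_of n g))"
    let ?\<phi> = "jordan_centrality (tree_of n g)"
    have small: "desc_count g n u \<le> z" if "u \<in> desc g n v" "u \<noteq> v" for u
    proof -
      have "v < u" "u \<le> n" using desc_ge[OF that(1)] that by (auto simp: desc_def)
      then show ?thesis using P that by (auto simp: P_def D_def not_less)
    qed
    have \<phi>v: "z < ?\<phi> v"
    proof (rule centrality_greaterI[OF g v(1) n(5)])
      show "z < desc_count g n v" using P by (simp add: P_def)
      fix c assume c: "c \<in> {2..n}" "g c = v"
      have cv: "c \<noteq> v" using parent_less[OF g c(1)] c(2) by auto
      then have "c \<in> desc g n v" using desc_parent[OF g c(1) cv] desc_self[OF v(1)] c(2) n by simp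
      then have "desc_count g n c \<le> z" using small cv by blast
      then show "z < n - desc_count g n c" using zn by linarith
    qed
    have "{u\<in>{1..n}. ?\<phi> v \<le> ?\<phi> u} \<subseteq> insert v ({1..k} \<union> {u\<in>?J. N g u})"
    proof
      fix u assume u: "u \<in> {u\<in>{1..n}. ?\<phi> v \<le> ?\<phi> u}"
      show "u \<in> insert v ({1..k} \<union> {u\<in>?J. N g u})"
      proof (cases "u \<le> k \<or> u = v")
        case False
        then have "u \<in> {2..n}" using u k(3) by auto
        then have zu: "z < desc_count g n u" using centrality_le_desc[OF g] u \<phi>v by fastforce
        then have "u \<notin> desc g n v" using small[of u] False by auto
        then show ?thesis using False u zu P by (auto simp: N_def P_def)
      qed (use u in auto)
    qed
    then have "card {u\<in>{1..n}. ?\<phi> v \<le> ?\<phi> u} \<le> card (insert v ({1..k} \<union> {u\<in>?J. N g u}))"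
      by (intro card_mono) auto
    also have "\<dots> \<le> Suc (card ({1..k} \<union> {u\<in>?J. N g u}))" by (rule card_insert_le_m1) auto
    also have "\<dots> \<le> Suc (k + card {u\<in>?J. N g u})"
      using card_Un_le[of "{1..k}" "{u\<in>?J. N g u}"] by simp
    finally have "\<sigma> v \<le> Suc (k + card {u\<in>?J. N g u})" using card_rank_le[OF \<sigma> _ v(1)] by simp
    then have "real (\<sigma> v) \<le> 1 + real k + real (card {u\<in>?J. N g u})" by linarith
    also have "\<dots> \<le> R" using P k R by (simp add: P_def)
    finally show "real (\<sigma> v) \<le> 1 / S * real v" by (simp add: R_def)
  qed (use n in simp)
  moreover have "\<pi> * p / 2 \<le> expect (random_parents n) (\<lambda>g. of_bool (P g))"
  proof -
    let ?G = "\<lambda>g. g v \<le> k \<and> z < desc_count g n v"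
    have fin: "finite (set_pmf (random_parents n))" by simp
    have G: "expect (random_parents n) (\<lambda>g. of_bool (?G g)) = \<pi> * p"
      unfolding \<pi>_def p_def by (rule expect_parent_and_large[OF n(3,4) k(4)])
    have D: "expect (random_parents n) (\<lambda>g. of_bool (D g u)) \<le> \<pi> * (tail u n z / real v)" if "u \<in> {v<..n}" for u
    proof -
      have "expect (random_parents n) (\<lambda>g. of_bool (g v \<le> k) * of_bool (u \<in> desc g n v \<and> z < desc_count g n u))
          \<le> real k / real (v - 1) * (tail u n z / real v)"
        using that n expect_desc_and_large[of v _ u n z]
        by (intro expect_parent_indep_le[OF n(3,4) k(4)]) auto
      then show ?thesis by (simp add: D_def \<pi>_def of_bool_conj)
    qed
    have "(\<Sum>u\<in>{v<..n}. expect (random_parents n) (\<lambda>g. of_bool (D g u))) \<le>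
        (\<Sum>u\<in>{v<..n}. \<pi> * (tail u n z / real v))"
      by (rule sum_mono) (rule D)
    also have "\<dots> = \<pi> * ((\<Sum>u\<in>{v<..n}. tail u n z) / real v)"
      by (simp only: sum_distrib_left sum_divide_distrib)
    finally have D_le: "(\<Sum>u\<in>{v<..n}. expect (random_parents n) (\<lambda>g. of_bool (D g u))) \<le>
        \<pi> * ((\<Sum>u\<in>{v<..n}. tail u n z) / real v)" .
    have "(\<Sum>u\<in>{v<..n}. tail u n z) \<le> (\<Sum>u\<in>{v..n}. tail u n z)"
      by (intro sum_mono2) (auto simp: tail_nonneg)
    also have "\<dots> \<le> p * b"
      unfolding p_def b_def by (rule sum_tail_after_le[OF n(5) z(3) zn(1) n(6)])
    finally have "(\<Sum>u\<in>{v<..n}. tail u n z) \<le> p * b" .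
    then have "\<pi> * ((\<Sum>u\<in>{v<..n}. tail u n z) / real v) \<le> \<pi> * (p * b / real v)"
      using \<pi>0 by (intro mult_left_mono divide_right_mono) auto
    also have "\<dots> \<le> \<pi> * (p * (R / 16) / R)"
      using \<pi>0 p0 b R by (intro mult_left_mono frac_le) auto
    also have "\<dots> = \<pi> * p / 16" using R by simp
    finally have sumD: "(\<Sum>u\<in>{v<..n}. expect (random_parents n) (\<lambda>g. of_bool (D g u))) \<le> \<pi> * p / 16"
      using D_le by linarith
    have N: "expect (random_parents n) (\<lambda>g. of_bool (N g u)) \<le> \<pi> * (tail u n z * p)" if u: "u \<in> ?J" for u
    proof (cases "v < u")
      case True
      have "expect (random_parents n) (\<lambda>g. of_bool (g v \<le> k) *
            of_bool (u \<notin> desc g n v \<and> z < desc_count g n v \<and> z < desc_count g n u))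
          \<le> real k / real (v - 1) * (tail v n z * tail u n z)"
        using u True n expect_incomparable_le[of v _ u n z]
        by (intro expect_parent_indep_le[OF n(3,4) k(4)]) auto
      then show ?thesis
        by (simp add: N_def \<pi>_def p_def of_bool_conj mult_ac)
    next
      case False
      have "expect (random_parents n) (\<lambda>g. of_bool (N g u)) \<le>
          expect (random_parents n) (\<lambda>g. of_bool (g v \<le> k \<and> z < desc_count g n u \<and> z < desc_count g n v))"
        by (rule expect_mono[OF fin]) (auto simp: N_def)
      also have "\<dots> \<le> real k / real (v - 1) * (tail u n z * tail v n z)"
        using u False by (intro expect_parent_older_le[OF k(3) _ _ n(4)]) auto
      finally show ?thesis by (simp add: \<pi>_def p_def)
    qed
    have "(\<Sum>u\<in>?J. expect (random_parents n) (\<lambda>g. of_bool (N g u))) \<le> (\<Sum>u\<in>?J. \<pi> * (tail u n z * p))"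
      by (rule sum_mono) (rule N)
    also have "\<dots> = \<pi> * ((\<Sum>u\<in>?J. tail u n z) * p)"
      by (simp only: sum_distrib_left sum_distrib_right)
    finally have N_le: "(\<Sum>u\<in>?J. expect (random_parents n) (\<lambda>g. of_bool (N g u))) \<le>
        \<pi> * ((\<Sum>u\<in>?J. tail u n z) * p)" .
    have "(\<Sum>u\<in>?J. tail u n z) \<le> (\<Sum>u\<in>{k<..n}. tail u n z)"
      by (intro sum_mono2) (auto simp: tail_nonneg)
    also have "\<dots> \<le> R / 16"
      using order_trans[OF sum_tail_le[OF n(5) z(3) zn(1) k(3)] b(2)[unfolded b_def]] .
    finally have "\<pi> * ((\<Sum>u\<in>?J. tail u n z) * p) \<le> \<pi> * (R / 16 * p)"
      using \<pi>0 p0 by (intro mult_left_mono mult_right_mono) auto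
    then have sumN: "(\<Sum>u\<in>?J. expect (random_parents n) (\<lambda>g. of_bool (N g u))) \<le> \<pi> * (R / 16 * p)"
      using N_le by linarith
    have "\<pi> * p / 2 \<le> \<pi> * p - \<pi> * p / 16 - 4 / R * (\<pi> * (R / 16 * p))"
      using \<pi>0 p0 R by (simp add: field_simps)
    also have "\<dots> \<le> expect (random_parents n) (\<lambda>g. of_bool (?G g))
        - (\<Sum>u\<in>{v<..n}. expect (random_parents n) (\<lambda>g. of_bool (D g u)))
        - 4 / R * (\<Sum>u\<in>?J. expect (random_parents n) (\<lambda>g. of_bool (N g u)))"
      unfolding G using sumD sumN R \<pi>0 p0 by (intro diff_mono mult_left_mono) auto
    also have "\<dots> = expect (random_parents n) (\<lambda>g. of_bool (?G g) - (\<Sum>u\<in>{v<..n}. of_bool (D g u))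
        - 4 / R * (\<Sum>u\<in>?J. of_bool (N g u)))"
      unfolding expect_diff[OF fin] integral_mult_right_zero expect_sum[OF fin] by simp
    also have "\<dots> \<le> expect (random_parents n) (\<lambda>g. of_bool (P g))"
    proof (rule expect_mono[OF fin])
      fix g
      have Dge: "of_bool (\<exists>u\<in>{v<..n}. D g u) \<le> (\<Sum>u\<in>{v<..n}. of_bool (D g u) :: real)"
      proof (cases "\<exists>u\<in>{v<..n}. D g u")
        case True
        then obtain u where u: "u \<in> {v<..n}" "D g u" by blast
        then have "(of_bool (D g u) :: real) \<le> (\<Sum>u\<in>{v<..n}. of_bool (D g u))"
          by (intro member_le_sum) auto
        then show ?thesis using True u by simp
      qed (simp add: sum_nonneg)
      have Nge: "of_bool (\<not> real (card {u\<in>?J. N g u}) < R / 4) \<le> 4 / R * (\<Sum>u\<in>?J. of_bool (N g u) :: real)"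
      proof -
        have "(\<Sum>u\<in>?J. of_bool (N g u) :: real) = real (card {u\<in>?J. N g u})"
          by (rule card_eq_sum_of_bool[symmetric]) simp
        then show ?thesis using R by (simp add: field_simps)
      qed
      have "of_bool (?G g) - of_bool (\<exists>u\<in>{v<..n}. D g u) - of_bool (\<not> real (card {u\<in>?J. N g u}) < R / 4)
          \<le> (of_bool (P g) :: real)"
        unfolding P_def by (auto simp del: of_bool_eq_0_iff)
      then show "of_bool (?G g) - (\<Sum>u\<in>{v<..n}. of_bool (D g u))
          - 4 / R * (\<Sum>u\<in>?J. of_bool (N g u)) \<le> (of_bool (P g) :: real)"
        using Dge Nge by linarith
    qed
    finally show ?thesis .
  qed
  moreover have "1 / 16 * exp (- 69 * S) \<le> \<pi> * p / 2"
  proof -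
    define t where "t = real z / real (n - v + 1)"
    have t: "0 \<le> t" "t \<le> 34 / R" "t \<le> 1 / 2"
    proof -
      show "0 \<le> t" by (simp add: t_def)
      have "t \<le> (17 * real n / R) / (real n / 2)"
        unfolding t_def using z n R by (intro frac_le) (auto simp: of_nat_diff)
      also have "\<dots> = 34 / R" using n by simp
      finally show tR: "t \<le> 34 / R" .
      also have "34 / R \<le> 34 / 128" using R by (intro divide_left_mono) auto
      finally show "t \<le> 1 / 2" by simp
    qed
    have zv: "z \<le> n - v + 1" using zn n by linarith
    have "exp (- 68 * S) \<le> exp (real (v - 1) * (- 2 * t))"
    proof -
      have "real (v - 1) * (2 * t) \<le> real v * (2 * (34 / R))"
        using t by (intro mult_mono) auto
      also have "\<dots> = 68 * S" using R by (simp add: field_simps)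
      finally show ?thesis by simp
    qed
    also have "\<dots> = exp (- 2 * t) ^ (v - 1)" by (rule exp_of_nat_mult)
    also have "\<dots> \<le> (1 - t) ^ (v - 1)" using exp_le_one_minus[OF t(1,3)] by (intro power_mono) auto
    also have "\<dots> \<le> p" unfolding p_def t_def using n zv by (intro tail_ge_power) auto
    finally have p: "exp (- 68 * S) \<le> p" .
    have "exp (- S) \<le> 1 / S"
    proof -
      have "S \<le> exp S" using exp_ge_add_one_self[of S] by linarith
      then show ?thesis using S by (simp add: exp_minus field_simps)
    qed
    then have "1 / 8 * exp (- S) \<le> 1 / (8 * S)" by simp
    also have "\<dots> = (R / 8) / real v" using S n by (simp add: R_def)
    also have "\<dots> \<le> \<pi>" unfolding \<pi>_def using k n by (intro frac_le) auto
    finally have "(1 / 8 * exp (- S)) * exp (- 68 * S) \<le> \<pi> * p"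
      using p \<pi>0 by (intro mult_mono) auto
    moreover have "exp (- S) * exp (- 68 * S) = exp (- 69 * S)" by (simp add: exp_add[symmetric])
    ultimately show ?thesis by simp
  qed
  ultimately show ?thesis by linarith
qed

theorem theorem1p5:
  shows "(\<exists>c C \<delta> :: real. c > 0 \<and> C > 0 \<and> \<delta> > 0 \<and>
      (\<forall>n\<ge>1. \<forall>v\<in>{1..n}. \<forall>S::real.
        (S \<in> {1..\<delta> * real n / real v} \<longrightarrow>
          c / S \<le> measure_pmf.prob (rrt_jordan_ordering n) {\<sigma>. real (\<sigma> v) \<ge> S * real v}) \<and>
        (S \<ge> 1 \<longrightarrow>
          measure_pmf.prob (rrt_jordan_ordering n) {\<sigma>. real (\<sigma> v) \<ge> S * real v} \<le> C / S)))
    \<and> (\<exists>c' c'' C' C'' \<delta>' :: real. c' > 0 \<and> c'' > 0 \<and> C' > 0 \<and> C'' > 0 \<and> \<delta>' > 0 \<and>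
      (\<forall>n\<ge>1. \<forall>v\<in>{1..n}. \<forall>S::real.
        (real v \<le> real n / 2 \<and> S \<in> {1..\<delta>' * real v} \<longrightarrow>
          c'' * exp (- C'' * S)
            \<le> measure_pmf.prob (rrt_jordan_ordering n) {\<sigma>. real (\<sigma> v) \<le> 1 / S * real v}) \<and>
        (S \<in> {1..sqrt (real v)} \<longrightarrow>
          measure_pmf.prob (rrt_jordan_ordering n) {\<sigma>. real (\<sigma> v) \<le> 1 / S * real v}
            \<le> C' * exp (- c' * S))))"
proof (rule conjI)
  have ge: "1 / 10000 / S \<le> measure_pmf.prob (rrt_jordan_ordering n) {\<sigma>. real (\<sigma> v) \<ge> S * real v}"
    if "v \<in> {1..n}" "S \<in> {1..1 / 1000 * real n / real v}" for n v S
    using rank_upper_tail_ge[OF that(1)] that(2) by simp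
  show "\<exists>c C \<delta> :: real. c > 0 \<and> C > 0 \<and> \<delta> > 0 \<and>
      (\<forall>n\<ge>1. \<forall>v\<in>{1..n}. \<forall>S::real.
        (S \<in> {1..\<delta> * real n / real v} \<longrightarrow>
          c / S \<le> measure_pmf.prob (rrt_jordan_ordering n) {\<sigma>. real (\<sigma> v) \<ge> S * real v}) \<and>
        (S \<ge> 1 \<longrightarrow>
          measure_pmf.prob (rrt_jordan_ordering n) {\<sigma>. real (\<sigma> v) \<ge> S * real v} \<le> C / S))"
    by (rule exI[of _ "1 / 10000"], rule exI[of _ 100], rule exI[of _ "1 / 1000"])
       (intro conjI, simp, simp, simp, use ge rank_upper_tail_le in blast)
  show "\<exists>c' c'' C' C'' \<delta>' :: real. c' > 0 \<and> c'' > 0 \<and> C' > 0 \<and> C'' > 0 \<and> \<delta>' > 0 \<and>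
      (\<forall>n\<ge>1. \<forall>v\<in>{1..n}. \<forall>S::real.
        (real v \<le> real n / 2 \<and> S \<in> {1..\<delta>' * real v} \<longrightarrow>
          c'' * exp (- C'' * S)
            \<le> measure_pmf.prob (rrt_jordan_ordering n) {\<sigma>. real (\<sigma> v) \<le> 1 / S * real v}) \<and>
        (S \<in> {1..sqrt (real v)} \<longrightarrow>
          measure_pmf.prob (rrt_jordan_ordering n) {\<sigma>. real (\<sigma> v) \<le> 1 / S * real v}
            \<le> C' * exp (- c' * S)))"
    by (rule exI[of _ "1 / 512"], rule exI[of _ "1 / 16"], rule exI[of _ 2], rule exI[of _ 69],
        rule exI[of _ "1 / 128"])
       (use rank_lower_tail_ge rank_lower_tail_le in auto)
qed

end
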